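(* Let there be $n$ samples at a non-leaf node $v$, and let $f_1,f_2$ be two given split rules at $v$. Let $C$ be any one of the three split criteria $\mathrm{gain}_{\mathrm{Gini}}$, $\mathrm{gain}_{\mathrm{MC}}$, $G_{\mathrm{Twoing}}$, and suppose that in the noise-free case the value of $C$ for $f_1$ is higher than that for $f_2$; let $\rho:=C(f_1)-C(f_2)>0$ denote the difference. Then, under symmetric label noise with rate $\eta\neq 0.5$, the value of the criterion computed from the noisy labels is higher for $f_1$ than for $f_2$, i.e. $\hat C^{\eta}(f_1)>\hat C^{\eta}(f_2)$, with probability at least $1-\delta$ when $$n\ \ge\ \mathcal{O}\Bigl(\frac{1}{\rho^{2}(1-2\eta)^{2}}\ln\Bigl(\frac1\delta\Bigr)\Bigr).$$
   Context: The node $v$ has samples $(\mathbf{x}_1,y_1),\dots,(\mathbf{x}_n,y_n)$ with $y_i\in\{+1,-1\}$. A split rule $f$ is a function of the feature vector only; it sends each sample at $v$ to the left child $v_l$ or the right child $v_r$. Let $a$ be the fraction of samples at $v$ sent to $v_l$. Let $p,q=1-p$ be the fractions of positive and negative samples at $v$, and $p_l,q_l=1-p_l$ and $p_r,q_r=1-p_r$ the corresponding fractions among the samples at $v_l$ and $v_r$. Impurity of a node with class fractions $p,q$: Gini impurity $G_{\mathrm{Gini}}=2pq$; misclassification impurity $G_{\mathrm{MC}}=\min\{p,q\}$. For such an impurity $G$, the corresponding gain of $f$ (denoted $\mathrm{gain}_{\mathrm{Gini}}(f)$ or $\mathrm{gain}_{\mathrm{MC}}(f)$) is $G(v)-\bigl(a\,G(v_l)+(1-a)\,G(v_r)\bigr)$.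 The twoing criterion is $G_{\mathrm{Twoing}}(f)=\frac{a(1-a)}{4}\bigl[|p_l-p_r|+|q_l-q_r|\bigr]^2$. Symmetric label noise with rate $\eta\in[0,1]$: each of the $n$ labels is flipped independently with probability $\eta$; the feature vectors (hence the samples going to each child, and $a$) are unchanged. $C(f)$ denotes the criterion computed from the true labels $y_i$ (the noise-free case), and $\hat C^{\eta}(f)$ the (random) value of the same formula computed from the noisy labels, i.e. with the class fractions at $v,v_l,v_r$ replaced by the fractions of noisy labels. The probability is over the random label flips, and $\delta\in(0,1)$ is the allowed failure probability. The notation $n\ge\mathcal{O}(\cdot)$ means that $n$ is at least a constant multiple of the displayed quantity, the constant being numerical (not depending on $n,\rho,\eta,\delta$ or the splits). *)

theory Defs
  imports "HOL-Probability.Probability"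
begin

text \<open>
  The samples at a node are indexed by \<open>{..<n}\<close>; sample \<open>i\<close> has feature vector \<open>x i\<close> and label
  \<open>y i \<in> {1, -1}\<close>. Feature vectors are lists of reals, so that the dimension is an ordinary variable
  and a constant can be quantified before it. A split rule is a predicate on feature vectors;
  \<open>True\<close> means that the sample goes to the left child.
\<close>

definition left_child :: "nat \<Rightarrow> (nat \<Rightarrow> real list) \<Rightarrow> (real list \<Rightarrow> bool) \<Rightarrow> nat set" where
  "left_child n x f = {i. i < n \<and> f (x i)}"

definition right_child :: "nat \<Rightarrow> (nat \<Rightarrow> real list) \<Rightarrow> (real list \<Rightarrow> bool) \<Rightarrow> nat set" where
  "right_child n x f = {i. i < n \<and> \<not> f (x i)}"

definition left_frac :: "nat \<Rightarrow> (nat \<Rightarrow> real list) \<Rightarrow> (real list \<Rightarrow> bool) \<Rightarrow> real" where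
  "left_frac n x f = real (card (left_child n x f)) / real n"

text \<open>
  On an empty child both class fractions below are \<open>0 / 0 = 0\<close>. This does not affect any criterion,
  since an empty child of a nonempty node has weight \<open>0\<close> in the gains, and the factor
  \<open>a * (1 - a)\<close> of the twoing criterion is then \<open>0\<close>.
\<close>

definition pos_frac :: "(nat \<Rightarrow> int) \<Rightarrow> nat set \<Rightarrow> real" where
  "pos_frac y V = real (card {i \<in> V. y i = 1}) / real (card V)"

definition neg_frac :: "(nat \<Rightarrow> int) \<Rightarrow> nat set \<Rightarrow> real" where
  "neg_frac y V = real (card {i \<in> V. y i = -1}) / real (card V)"

definition gini :: "real \<Rightarrow> real \<Rightarrow> real" where
  "gini p q = 2 * p * q"

definition misclass :: "real \<Rightarrow> real \<Rightarrow> real" where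
  "misclass p q = min p q"

definition node_impurity :: "(real \<Rightarrow> real \<Rightarrow> real) \<Rightarrow> (nat \<Rightarrow> int) \<Rightarrow> nat set \<Rightarrow> real" where
  "node_impurity G y V = G (pos_frac y V) (neg_frac y V)"

definition gain ::
  "(real \<Rightarrow> real \<Rightarrow> real) \<Rightarrow> nat \<Rightarrow> (nat \<Rightarrow> real list) \<Rightarrow> (nat \<Rightarrow> int) \<Rightarrow> (real list \<Rightarrow> bool) \<Rightarrow> real" where
  "gain G n x y f =
     node_impurity G y {..<n}
     - (left_frac n x f * node_impurity G y (left_child n x f)
        + (1 - left_frac n x f) * node_impurity G y (right_child n x f))"

definition twoing ::
  "nat \<Rightarrow> (nat \<Rightarrow> real list) \<Rightarrow> (nat \<Rightarrow> int) \<Rightarrow> (real list \<Rightarrow> bool) \<Rightarrow> real" where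
  "twoing n x y f =
     left_frac n x f * (1 - left_frac n x f) / 4 *
       (\<bar>pos_frac y (left_child n x f) - pos_frac y (right_child n x f)\<bar>
        + \<bar>neg_frac y (left_child n x f) - neg_frac y (right_child n x f)\<bar>)\<^sup>2"

definition noisy_labels :: "nat \<Rightarrow> real \<Rightarrow> (nat \<Rightarrow> int) \<Rightarrow> (nat \<Rightarrow> int) pmf" where
  "noisy_labels n \<eta> y =
     map_pmf (\<lambda>flip i. if flip i then - y i else y i)
       (Pi_pmf {..<n} False (\<lambda>_. bernoulli_pmf \<eta>))"

end

theory Submission
  imports Defs
begin

text \<open>
  Write the noisy labels as \<open>y i * \<epsilon> i\<close> with independent signs of mean \<open>\<mu> = 1 - 2 * \<eta>\<close>, and put
  \<open>t = n * \<mu>\<^sup>2 * \<rho>\<^sup>2\<close>. The failure probability has to be at most \<open>exp (- t / K)\<close>. For large \<open>t\<close> this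
  is Hoeffding's inequality and a union bound. As there is no factor in front of the exponential, for
  small \<open>t\<close> the success probability must be bounded below by a multiple of \<open>min 1 t\<close>.

  The Gini gain and the twoing criterion are multiples of the square of one linear form in the labels,
  whose squared weights sum to \<open>n\<close>. A difference of two such squares is a product of two linear forms,
  uncorrelated if both splits are nontrivial, and each of them only has to keep its sign; this is why
  the bound contains \<open>\<mu>\<^sup>2\<close> and not \<open>\<mu>\<^sup>4\<close>. The product has nonnegative expectation, so it is positive
  with constant probability if \<open>\<bar>\<mu>\<bar>\<close> is bounded away from 1, by a fourth moment (hypercontractive)
  bound, and with probability of order at least \<open>min 1 t\<close> otherwise, by the second moment method.

  The misclassification gain is \<open>(\<bar>L\<bar> + \<bar>R\<bar> - \<bar>L + R\<bar>) / (2 * n)\<close> for the label sums \<open>L\<close>, \<open>R\<close> of the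
  children. The first split wins as soon as four signed sums over sets of samples are positive: over its
  children, and over the samples on which the two splits agree or differ. All four events are monotone
  in the same signs, so Harris' inequality reduces the claim to a single sum.
\<close>

section \<open>Moments of polynomials in the noise\<close>

definition sg :: "bool \<Rightarrow> real" where
  "sg b = (if b then - 1 else 1)"

lemma sg_simps [simp]: "sg True = - 1" "sg False = 1" "\<bar>sg b\<bar> = 1"
  by (auto simp: sg_def)

lemma sum_squares_pos:
  fixes u :: "'a \<Rightarrow> real"
  assumes "finite A" "(\<Sum>i\<in>A. u i) \<noteq> 0"
  shows "0 < (\<Sum>i\<in>A. (u i)\<^sup>2)"
proof -
  obtain i where "i \<in> A" "u i \<noteq> 0"
    using assms(2) by (meson sum.neutral)
  then show ?thesis
    using assms(1) by (intro sum_pos2[of A i]) auto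
qed

section \<open>Independent biased flips and their expectations\<close>

locale flip_rate =
  fixes \<eta> :: real
  assumes eta_nonneg: "0 \<le> \<eta>" and eta_le_1: "\<eta> \<le> 1"
begin

definition flips :: "'a set \<Rightarrow> ('a \<Rightarrow> bool) pmf" where
  "flips A = Pi_pmf A False (\<lambda>_. bernoulli_pmf \<eta>)"

abbreviation E :: "'a set \<Rightarrow> (('a \<Rightarrow> bool) \<Rightarrow> real) \<Rightarrow> real" where
  "E A f \<equiv> measure_pmf.expectation (flips A) f"

abbreviation \<mu> :: real where
  "\<mu> \<equiv> 1 - 2 * \<eta>"

abbreviation V :: real where
  "V \<equiv> 4 * \<eta> * (1 - \<eta>)"

text \<open>The centred sign: it has mean 0 and variance \<open>V\<close>, which equals
  \<open>1 - \<mu>\<^sup>2\<close>.\<close>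

definition cs :: "bool \<Rightarrow> real" where
  "cs b = sg b - \<mu>"

lemma finite_set_flips: "finite A \<Longrightarrow> finite (set_pmf (flips A))"
  unfolding flips_def
  by (subst set_Pi_pmf) (auto intro!: finite_PiE_dflt)

lemma integrable_flips [simp]:
  "finite A \<Longrightarrow> integrable (measure_pmf (flips A)) (f :: _ \<Rightarrow> real)"
  by (intro integrable_measure_pmf_finite finite_set_flips)

lemma E_empty: "E {} f = f (\<lambda>_. False)"
  by (simp add: flips_def)

text \<open>Conditioning on the flip at \<open>a\<close>. The moment computations below and Harris'
  inequality are inductions on the index set by means of this identity.\<close>

lemma E_insert:
  assumes "finite A" "a \<notin> A"
  shows "E (insert a A) f = \<eta> * E A (\<lambda>w. f (w(a := True))) + (1 - \<eta>) * E A (\<lambda>w. f (w(a := False)))"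
proof -
  let ?P = "Pi_pmf A False (\<lambda>_. bernoulli_pmf \<eta>)"
  have fin: "finite (set_pmf ?P)"
    using finite_set_flips[OF assms(1)] by (simp add: flips_def)
  have "flips (insert a A) = bernoulli_pmf \<eta> \<bind> (\<lambda>b. map_pmf (\<lambda>w. w(a := b)) ?P)"
    using assms by (simp add: flips_def Pi_pmf_insert' map_pmf_def)
  then have "E (insert a A) f
      = (\<Sum>b\<in>UNIV. pmf (bernoulli_pmf \<eta>) b *\<^sub>R measure_pmf.expectation (map_pmf (\<lambda>w. w(a := b)) ?P) f)"
    using fin by (simp only:) (rule pmf_expectation_bind, auto)
  then show ?thesis
    using eta_nonneg eta_le_1 by (simp add: UNIV_bool flips_def)
qed

lemma E_mono: "finite A \<Longrightarrow> (\<And>w. f w \<le> g w) \<Longrightarrow> E A f \<le> E A g"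
  by (intro integral_mono) auto

lemma E_nonneg: "(\<And>w. 0 \<le> f w) \<Longrightarrow> 0 \<le> E A f"
  by (rule Bochner_Integration.integral_nonneg)

lemma prob_eq_E: "measure_pmf.prob (flips A) {w. P w} = E A (\<lambda>w. of_bool (P w))"
proof -
  have "(\<lambda>w. of_bool (P w) :: real) = indicator {w. P w}"
    by (auto simp: indicator_def)
  then show ?thesis by simp
qed

text \<open>Independence of the coordinate \<open>a\<close> in functional form: such a
  \<open>g\<close> passes unchanged through both branches of \<open>E_insert\<close>.\<close>

definition free_of :: "'a \<Rightarrow> (('a \<Rightarrow> bool) \<Rightarrow> real) \<Rightarrow> bool" where
  "free_of a g \<longleftrightarrow> (\<forall>w b. g (w(a := b)) = g w)"

lemma free_ofD: "free_of a g \<Longrightarrow> g (w(a := b)) = g w"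
  by (simp add: free_of_def)

lemma free_of_const: "free_of a (\<lambda>_. c)"
  by (simp add: free_of_def)

lemma free_of_sum: "a \<notin> A \<Longrightarrow> free_of a (\<lambda>w. \<Sum>i\<in>A. u i * F (w i))"
  unfolding free_of_def by (intro allI sum.cong) auto

lemma free_of_add: "free_of a g \<Longrightarrow> free_of a h \<Longrightarrow> free_of a (\<lambda>w. g w + h w)"
  by (simp add: free_of_def)

lemma free_of_mult: "free_of a g \<Longrightarrow> free_of a h \<Longrightarrow> free_of a (\<lambda>w. g w * h w)"
  by (simp add: free_of_def)

lemmas free_of_intros = free_of_const free_of_sum free_of_add free_of_mult

lemma cs_simps: "cs True = - 2 * (1 - \<eta>)" "cs False = 2 * \<eta>"
  by (auto simp: cs_def)

lemma V_bounds: "0 \<le> V" "V \<le> 1"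
proof -
  show "0 \<le> V" using eta_nonneg eta_le_1 by simp
  have "V = 1 - \<mu>\<^sup>2" by (simp add: power2_eq_square algebra_simps)
  then show "V \<le> 1" by simp
qed

section \<open>Moments of expressions affine in one more sign\<close>

lemma E_insert_affine:
  assumes "finite A" "a \<notin> A" "free_of a g" "free_of a h"
  shows "E (insert a A) (\<lambda>w. g w + cs (w a) * h w) = E A g"
proof -
  have "E (insert a A) (\<lambda>w. g w + cs (w a) * h w)
      = E A (\<lambda>w. \<eta> * (g w + cs True * h w) + (1 - \<eta>) * (g w + cs False * h w))"
    using assms by (simp add: E_insert free_ofD algebra_simps)
  also have "\<dots> = E A g"
    by (intro arg_cong[where f = "E A"] ext) (simp add: cs_simps algebra_simps)
  finally show ?thesis .
qed

text \<open>The cross term vanishes because \<open>cs (w a)\<close> is centred, and its second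
  moment is \<open>V\<close>.\<close>

lemma E_insert_square:
  assumes "finite A" "a \<notin> A" "free_of a g" "free_of a h"
  shows "E (insert a A) (\<lambda>w. (g w + cs (w a) * h w)\<^sup>2) = E A (\<lambda>w. (g w)\<^sup>2) + V * E A (\<lambda>w. (h w)\<^sup>2)"
proof -
  have "E (insert a A) (\<lambda>w. (g w + cs (w a) * h w)\<^sup>2)
      = E A (\<lambda>w. \<eta> * (g w + cs True * h w)\<^sup>2 + (1 - \<eta>) * (g w + cs False * h w)\<^sup>2)"
    using assms by (simp add: E_insert free_ofD)
  also have "\<dots> = E A (\<lambda>w. (g w)\<^sup>2 + V * (h w)\<^sup>2)"
    by (intro arg_cong[where f = "E A"] ext) (unfold cs_simps, algebra)
  finally show ?thesis
    using assms by simp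
qed

text \<open>\<open>m3\<close> and \<open>m4\<close> are the third and fourth moments of the centred
  sign.\<close>

definition m3 :: real where "m3 = 2 * V * (2 * \<eta> - 1)"
definition m4 :: real where "m4 = 4 * V * (1 - 3 * \<eta> * (1 - \<eta>))"

lemma E_insert_fourth:
  assumes "finite A" "a \<notin> A" "free_of a g" "free_of a h"
  shows "E (insert a A) (\<lambda>w. (g w + cs (w a) * h w)^4)
    = E A (\<lambda>w. (g w)^4 + 6 * V * ((g w)\<^sup>2 * (h w)\<^sup>2) + 4 * m3 * (g w * (h w)^3) + m4 * (h w)^4)"
proof -
  have "E (insert a A) (\<lambda>w. (g w + cs (w a) * h w)^4)
      = E A (\<lambda>w. \<eta> * (g w + cs True * h w)^4 + (1 - \<eta>) * (g w + cs False * h w)^4)"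
    using assms by (simp add: E_insert free_ofD)
  also have "\<dots> = E A (\<lambda>w. (g w)^4 + 6 * V * ((g w)\<^sup>2 * (h w)\<^sup>2) + 4 * m3 * (g w * (h w)^3) + m4 * (h w)^4)"
    by (intro arg_cong[where f = "E A"] ext) (unfold cs_simps m3_def m4_def, algebra)
  finally show ?thesis .
qed

lemma m3_bound: "\<bar>m3\<bar> \<le> 2 * V"
proof -
  have "\<bar>m3\<bar> = 2 * V * \<bar>2 * \<eta> - 1\<bar>"
    using eta_nonneg eta_le_1 by (simp add: m3_def abs_mult)
  also have "\<dots> \<le> 2 * V * 1"
    using V_bounds eta_nonneg eta_le_1 by (intro mult_left_mono) auto
  finally show ?thesis by simp
qed

lemma m4_bounds: "0 \<le> m4" "m4 \<le> 4 * V"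
proof -
  have "0 \<le> 1 - 3 * \<eta> * (1 - \<eta>)" "1 - 3 * \<eta> * (1 - \<eta>) \<le> 1"
    using V_bounds by auto
  then show "0 \<le> m4" "m4 \<le> 4 * V"
    unfolding m4_def using V_bounds mult_left_mono[of "1 - 3 * \<eta> * (1 - \<eta>)" 1 "4 * V"]
    by (auto intro: mult_nonneg_nonneg)
qed

text \<open>The expectation of \<open>(f w - t * g w)\<^sup>2\<close> is a nonnegative quadratic
  polynomial in \<open>t\<close>, so its discriminant is not positive.\<close>

lemma E_Cauchy_Schwarz:
  assumes "finite A"
  shows "(E A (\<lambda>w. f w * g w))\<^sup>2 \<le> E A (\<lambda>w. (f w)\<^sup>2) * E A (\<lambda>w. (g w)\<^sup>2)"
proof -
  define a b c where "a = E A (\<lambda>w. (g w)\<^sup>2)" and "b = E A (\<lambda>w. f w * g w)" and "c = E A (\<lambda>w. (f w)\<^sup>2)"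
  have quad: "0 \<le> c - 2 * t * b + t\<^sup>2 * a" for t
  proof -
    have "0 \<le> E A (\<lambda>w. (f w - t * g w)\<^sup>2)"
      by (intro E_nonneg) simp
    also have "(\<lambda>w. (f w - t * g w)\<^sup>2) = (\<lambda>w. (f w)\<^sup>2 - 2 * t * (f w * g w) + t\<^sup>2 * (g w)\<^sup>2)"
      by (simp add: power2_eq_square algebra_simps)
    finally show ?thesis
      using assms by (simp add: a_def b_def c_def)
  qed
  have "0 \<le> a" unfolding a_def by (intro E_nonneg) simp
  have "b\<^sup>2 \<le> c * a"
  proof (cases "a = 0")
    case True
    have "b = 0"
    proof (rule ccontr)
      assume "b \<noteq> 0"
      \<comment> \<open>For \<open>a = 0\<close> the polynomial is linear in \<open>t\<close>, and
        this \<open>t\<close> gives it the value -1.\<close>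
      then show False using quad[of "(c + 1) / (2 * b)"] True by simp
    qed
    then show ?thesis using True by simp
  next
    case False
    with \<open>0 \<le> a\<close> have "0 < a" by simp
    then show ?thesis using quad[of "b / a"]
      by (simp add: field_simps power2_eq_square)
  qed
  then show ?thesis by (simp add: a_def b_def c_def)
qed

text \<open>The induction step of Bonami's hypercontractivity argument; the factor per degree is 25 instead
  of the 9 of unbiased signs because the third moment of the noise does not vanish.\<close>
lemma fourth_moment_step:
  assumes "finite A" "a \<notin> A" "free_of a g" "free_of a h"
    and V: "3 / 4 \<le> V"
    and g: "E A (\<lambda>w. (g w)^4) \<le> 25 * \<kappa> * (E A (\<lambda>w. (g w)\<^sup>2))\<^sup>2"
    and h: "E A (\<lambda>w. (h w)^4) \<le> \<kappa> * (E A (\<lambda>w. (h w)\<^sup>2))\<^sup>2"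
    and k: "0 \<le> \<kappa>"
  shows "E (insert a A) (\<lambda>w. (g w + cs (w a) * h w)^4)
    \<le> 25 * \<kappa> * (E (insert a A) (\<lambda>w. (g w + cs (w a) * h w)\<^sup>2))\<^sup>2"
proof -
  define P Q where "P = E A (\<lambda>w. (g w)\<^sup>2)" and "Q = E A (\<lambda>w. (h w)\<^sup>2)"
  have PQ: "0 \<le> P" "0 \<le> Q"
    unfolding P_def Q_def by (intro E_nonneg; simp)+
  \<comment> \<open>The odd term is removed by
    \<open>2 * \<bar>y * z^3\<bar> \<le> y\<^sup>2 * z\<^sup>2 + z^4\<close>. With
    \<open>\<bar>m3\<bar> \<le> 2 * V\<close> this adds 4 to the coefficients 6 and 4 of
    \<open>V\<close>.\<close>
  have pt: "y^4 + 6 * V * (y\<^sup>2 * z\<^sup>2) + 4 * m3 * (y * z^3) + m4 * z^4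
      \<le> y^4 + 10 * V * (y\<^sup>2 * z\<^sup>2) + 8 * V * z^4" for y z :: real
  proof -
    have "2 * \<bar>y * z^3\<bar> \<le> y\<^sup>2 * z\<^sup>2 + z^4"
    proof -
      have "0 \<le> (\<bar>y\<bar> * \<bar>z\<bar> - z\<^sup>2)\<^sup>2" by simp
      also have "\<dots> = y\<^sup>2 * z\<^sup>2 + z^4 - 2 * \<bar>y * z^3\<bar>"
      proof -
        have "\<bar>y * z^3\<bar> = \<bar>y\<bar> * \<bar>z\<bar>^3" "y\<^sup>2 = \<bar>y\<bar>\<^sup>2" "z\<^sup>2 = \<bar>z\<bar>\<^sup>2" "z^4 = \<bar>z\<bar>^4"
          by (simp_all add: abs_mult power_abs)
        then show ?thesis by algebra
      qed
      finally show ?thesis by simp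
    qed
    then have "2 * V * (2 * \<bar>y * z^3\<bar>) \<le> 2 * V * (y\<^sup>2 * z\<^sup>2 + z^4)"
      using V by (intro mult_left_mono) auto
    moreover have "m3 * (y * z^3) \<le> \<bar>m3\<bar> * \<bar>y * z^3\<bar>"
      by (simp flip: abs_mult)
    moreover have "\<bar>m3\<bar> * \<bar>y * z^3\<bar> \<le> 2 * V * \<bar>y * z^3\<bar>"
      using m3_bound by (intro mult_right_mono) auto
    moreover have "m4 * z^4 \<le> 4 * V * z^4"
      using m4_bounds by (intro mult_right_mono) auto
    ultimately show ?thesis by (simp add: algebra_simps)
  qed
  \<comment> \<open>The geometric mean of the factors \<open>25 * \<kappa>\<close> and
    \<open>\<kappa>\<close> is \<open>5 * \<kappa>\<close>, exactly the cross term of the perfect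
    square formed below.\<close>
  have cross: "E A (\<lambda>w. (g w)\<^sup>2 * (h w)\<^sup>2) \<le> 5 * \<kappa> * P * Q"
  proof (rule power2_le_imp_le)
    have "(E A (\<lambda>w. (g w)\<^sup>2 * (h w)\<^sup>2))\<^sup>2 \<le> E A (\<lambda>w. ((g w)\<^sup>2)\<^sup>2) * E A (\<lambda>w. ((h w)\<^sup>2)\<^sup>2)"
      by (rule E_Cauchy_Schwarz) fact
    also have "\<dots> = E A (\<lambda>w. (g w)^4) * E A (\<lambda>w. (h w)^4)"
      by simp
    also have "\<dots> \<le> (25 * \<kappa> * P\<^sup>2) * (\<kappa> * Q\<^sup>2)"
      using g h k by (intro mult_mono) (auto simp: P_def Q_def intro!: E_nonneg)
    also have "\<dots> = (5 * \<kappa> * P * Q)\<^sup>2"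
      by (simp add: power2_eq_square)
    finally show "(E A (\<lambda>w. (g w)\<^sup>2 * (h w)\<^sup>2))\<^sup>2 \<le> (5 * \<kappa> * P * Q)\<^sup>2" .
    show "0 \<le> 5 * \<kappa> * P * Q" using PQ k by simp
  qed
  have "E (insert a A) (\<lambda>w. (g w + cs (w a) * h w)^4)
      \<le> E A (\<lambda>w. (g w)^4 + 10 * V * ((g w)\<^sup>2 * (h w)\<^sup>2) + 8 * V * (h w)^4)"
    unfolding E_insert_fourth[OF assms(1-4)] by (intro E_mono pt assms(1))
  also have "\<dots> = E A (\<lambda>w. (g w)^4) + 10 * V * E A (\<lambda>w. (g w)\<^sup>2 * (h w)\<^sup>2) + 8 * V * E A (\<lambda>w. (h w)^4)"
    using assms(1) by simp
  also have "\<dots> \<le> 25 * \<kappa> * P\<^sup>2 + 10 * V * (5 * \<kappa> * P * Q) + 8 * V * (\<kappa> * Q\<^sup>2)"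
    using g h cross V by (intro add_mono mult_left_mono) (auto simp: P_def Q_def)
  \<comment> \<open>As \<open>V\<close> is at least 3/4, \<open>8 \<le> 25 * V\<close>; enlarging
    the last term in this way completes the square.\<close>
  also have "8 * V * (\<kappa> * Q\<^sup>2) \<le> (25 * V) * V * (\<kappa> * Q\<^sup>2)"
    using V k by (intro mult_right_mono) auto
  also have "25 * \<kappa> * P\<^sup>2 + 10 * V * (5 * \<kappa> * P * Q) + (25 * V) * V * (\<kappa> * Q\<^sup>2) = 25 * \<kappa> * (P + V * Q)\<^sup>2"
    by (simp add: power2_eq_square algebra_simps)
  also have "P + V * Q = E (insert a A) (\<lambda>w. (g w + cs (w a) * h w)\<^sup>2)"
    using assms(1-4) by (simp add: E_insert_square P_def Q_def)
  finally show ?thesis by simp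
qed

lemma fourth_moment_affine:
  assumes "finite A" "3 / 4 \<le> V"
  shows "E A (\<lambda>w. (c + (\<Sum>i\<in>A. l i * cs (w i)))^4) \<le> 25 * (E A (\<lambda>w. (c + (\<Sum>i\<in>A. l i * cs (w i)))\<^sup>2))\<^sup>2"
  using assms(1)
proof (induction A rule: finite_induct)
  case empty
  have "c^4 = (c\<^sup>2)\<^sup>2" by simp
  then show ?case
    by (simp add: E_empty)
next
  case (insert a A)
  have *: "c + (\<Sum>i\<in>insert a A. l i * cs (w i)) = (c + (\<Sum>i\<in>A. l i * cs (w i))) + cs (w a) * l a" for w
    using insert by simp
  show ?case
    unfolding * using insert assms(2)
    by (intro fourth_moment_step[where \<kappa> = 1, simplified]) (auto intro!: free_of_intros)
qed

text \<open>A centred sign takes only two values, so its square is affine in it. This keeps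
  quadratic polynomials affine in each coordinate.\<close>

lemma cs_square: "(cs b)\<^sup>2 = V - 2 * \<mu> * cs b"
  by (cases b) (simp_all add: cs_simps power2_eq_square algebra_simps)

text \<open>The square of the new sign is reduced by \<open>cs_square\<close>, which shifts the
  constant and the linear coefficient at \<open>a\<close>. This is why the inductions below
  generalise over \<open>c\<close>.\<close>

lemma quadratic_insert:
  assumes "finite A" "a \<notin> A"
  shows "c + (\<Sum>i\<in>insert a A. l i * cs (w i))
        + (\<Sum>i\<in>insert a A. u i * cs (w i)) * (\<Sum>i\<in>insert a A. v i * cs (w i))
     = (c + u a * v a * V + (\<Sum>i\<in>A. l i * cs (w i)) + (\<Sum>i\<in>A. u i * cs (w i)) * (\<Sum>i\<in>A. v i * cs (w i)))
        + cs (w a) * (l a - 2 * \<mu> * u a * v a + (\<Sum>i\<in>A. (u a * v i + v a * u i) * cs (w i)))"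
proof -
  define x S T where "x = cs (w a)" and "S = (\<Sum>i\<in>A. u i * cs (w i))" and "T = (\<Sum>i\<in>A. v i * cs (w i))"
  have "(\<Sum>i\<in>A. (u a * v i + v a * u i) * cs (w i)) = u a * T + v a * S"
    by (simp add: S_def T_def sum.distrib sum_distrib_left algebra_simps)
  moreover have "(u a * x + S) * (v a * x + T) = u a * v a * x\<^sup>2 + x * (u a * T + v a * S) + S * T"
    by (simp add: power2_eq_square algebra_simps)
  moreover have "x\<^sup>2 = V - 2 * \<mu> * x"
    unfolding x_def by (rule cs_square)
  ultimately show ?thesis
    using assms by (simp add: flip: x_def S_def T_def) (simp add: algebra_simps)
qed

text \<open>In the induction the part multiplied by the new sign is affine and so has the factor 25;
  each degree costs one such factor.\<close>

lemma fourth_moment_quadratic: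
  assumes "finite A" "3 / 4 \<le> V"
  shows "E A (\<lambda>w. (c + (\<Sum>i\<in>A. l i * cs (w i)) + (\<Sum>i\<in>A. u i * cs (w i)) * (\<Sum>i\<in>A. v i * cs (w i)))^4)
    \<le> 625 * (E A (\<lambda>w. (c + (\<Sum>i\<in>A. l i * cs (w i)) + (\<Sum>i\<in>A. u i * cs (w i)) * (\<Sum>i\<in>A. v i * cs (w i)))\<^sup>2))\<^sup>2"
  using assms(1)
proof (induction A arbitrary: c rule: finite_induct)
  case empty
  have "c^4 = (c\<^sup>2)\<^sup>2" by simp
  then show ?case
    by (simp add: E_empty)
next
  case (insert a A)
  show ?case
    unfolding quadratic_insert[OF insert(1,2)] using insert assms(2)
    by (intro fourth_moment_step[where \<kappa> = 25, simplified] fourth_moment_affine)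
      (auto intro!: free_of_intros)
qed

lemma E_sum_cs: "finite A \<Longrightarrow> E A (\<lambda>w. \<Sum>i\<in>A. u i * cs (w i)) = 0"
proof (induction A rule: finite_induct)
  case (insert a A)
  have "E (insert a A) (\<lambda>w. (\<Sum>i\<in>A. u i * cs (w i)) + cs (w a) * u a) = 0"
    using insert by (subst E_insert_affine) (auto intro!: free_of_intros)
  then show ?case using insert by (simp add: algebra_simps)
qed (simp add: E_empty)

text \<open>Products of distinct centred signs have mean 0, so only the diagonal of the product
  contributes.\<close>

lemma E_quadratic:
  "finite A \<Longrightarrow> E A (\<lambda>w. c + (\<Sum>i\<in>A. l i * cs (w i)) + (\<Sum>i\<in>A. u i * cs (w i)) * (\<Sum>i\<in>A. v i * cs (w i)))
    = c + V * (\<Sum>i\<in>A. u i * v i)"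
proof (induction A arbitrary: c rule: finite_induct)
  case (insert a A)
  have sum: "(\<Sum>i\<in>insert a A. u i * v i) = u a * v a + (\<Sum>i\<in>A. u i * v i)"
    using insert by simp
  show ?case
    unfolding quadratic_insert[OF insert(1,2)] sum
    by (subst E_insert_affine[OF insert(1,2)], (intro free_of_intros insert(2))+)
      (simp only: insert.IH, simp add: algebra_simps)
qed (simp add: E_empty)

lemma E_sum_cs_square:
  "finite A \<Longrightarrow> E A (\<lambda>w. (\<Sum>i\<in>A. u i * cs (w i))\<^sup>2) = V * (\<Sum>i\<in>A. (u i)\<^sup>2)"
  using E_quadratic[of A 0 "\<lambda>_. 0" u u] by (simp add: power2_eq_square)

text \<open>Measured against the squared weights instead of the variance, the fourth moment is
  bounded for every rate, including rates near 0 or 1, where the kurtosis of a sign is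
  unbounded.\<close>

lemma fourth_moment_linear:
  assumes "finite A"
  shows "E A (\<lambda>w. (\<Sum>i\<in>A. u i * cs (w i))^4) \<le> 7 * (\<Sum>i\<in>A. (u i)\<^sup>2)\<^sup>2"
  using assms
proof (induction A rule: finite_induct)
  case (insert a A)
  define s g where "s = (\<Sum>i\<in>A. (u i)\<^sup>2)" and "g = (\<lambda>w. \<Sum>i\<in>A. u i * cs (w i))"
  have s: "0 \<le> s" by (auto simp: s_def intro!: sum_nonneg)
  have Eg: "E A g = 0" "E A (\<lambda>w. (g w)\<^sup>2) = V * s" "E A (\<lambda>w. (g w)^4) \<le> 7 * s\<^sup>2"
    using insert E_sum_cs[OF insert(1), of u] E_sum_cs_square[OF insert(1), of u]
    by (simp_all only: g_def s_def)
  have "E (insert a A) (\<lambda>w. (\<Sum>i\<in>insert a A. u i * cs (w i))^4)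
      = E (insert a A) (\<lambda>w. (g w + cs (w a) * u a)^4)"
    using insert by (simp add: g_def algebra_simps)
  also have "\<dots> = E A (\<lambda>w. (g w)^4) + 6 * V * (E A (\<lambda>w. (g w)\<^sup>2) * (u a)\<^sup>2)
      + 4 * m3 * (E A g * (u a)^3) + m4 * (u a)^4"
    using insert by (subst E_insert_fourth) (auto simp: g_def intro!: free_of_intros)
  also have "\<dots> \<le> 7 * s\<^sup>2 + 6 * (s * (u a)\<^sup>2) + 4 * (u a)^4"
  proof -
    have "V * V \<le> 1 * 1" using V_bounds by (intro mult_mono) auto
    then have "V * V * (s * (u a)\<^sup>2) \<le> 1 * 1 * (s * (u a)\<^sup>2)"
      using s by (intro mult_right_mono) auto
    moreover have "m4 * (u a)^4 \<le> 4 * (u a)^4"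
      using m4_bounds V_bounds by (intro mult_right_mono) auto
    moreover have "6 * V * (V * s * (u a)\<^sup>2) = 6 * (V * V * (s * (u a)\<^sup>2))"
      by (simp only: ac_simps)
    ultimately show ?thesis unfolding Eg(1,2) using Eg(3) by linarith
  qed
  also have "\<dots> \<le> 7 * (s + (u a)\<^sup>2)\<^sup>2"
  proof -
    have "(s + (u a)\<^sup>2)\<^sup>2 = s\<^sup>2 + 2 * (s * (u a)\<^sup>2) + (u a)^4"
      by algebra
    moreover have "0 \<le> s * (u a)\<^sup>2" "0 \<le> (u a)^4" using s by auto
    ultimately show ?thesis by linarith
  qed
  also have "s + (u a)\<^sup>2 = (\<Sum>i\<in>insert a A. (u i)\<^sup>2)"
    using insert by (simp add: s_def)
  finally show ?case by simp
qed (simp add: E_empty)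

end

section \<open>Lower bounds for success probabilities\<close>

text \<open>Integrating this minorant turns a bound on the kurtosis into a lower bound on the probability
  of positivity.\<close>
lemma of_bool_pos_ge:
  fixes z :: real
  shows "(z + z\<^sup>2 - 4 / 27 * z^4) / 5 \<le> of_bool (0 < z)"
proof (cases "0 < z")
  case True
  have "z + z\<^sup>2 - 4 / 27 * z^4 = 5 - (4 / 27 * (z\<^sup>2 - 81 / 16)\<^sup>2 + (z - 1)\<^sup>2 / 2 + 45 / 64)"
    by (simp add: field_simps power2_eq_square power4_eq_xxxx)
  also have "\<dots> \<le> 5"
    using zero_le_power2[of "z\<^sup>2 - 81 / 16"] zero_le_power2[of "z - 1"] by linarith
  finally show ?thesis using True by simp
next
  case False
  \<comment> \<open>The coefficient 4/27 is the smallest one for which the polynomial is nonpositive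
    on the negative axis: it produces a double root at -3/2.\<close>
  have "z + z\<^sup>2 - 4 / 27 * z^4 = z * (4 / 27 * ((z + 3 / 2)\<^sup>2 * (3 - z)))"
    by (simp add: field_simps power2_eq_square power4_eq_xxxx)
  also have "\<dots> \<le> 0" using False by (intro mult_nonpos_nonneg) auto
  finally show ?thesis using False by simp
qed

context flip_rate
begin

abbreviation Pr :: "'a set \<Rightarrow> (('a \<Rightarrow> bool) \<Rightarrow> bool) \<Rightarrow> real" where
  "Pr A P \<equiv> E A (\<lambda>w. of_bool (P w))"

lemma Pr_mono: "finite A \<Longrightarrow> (\<And>w. P w \<Longrightarrow> Q w) \<Longrightarrow> Pr A P \<le> Pr A Q"
  by (intro E_mono) auto

lemma Pr_not: "finite A \<Longrightarrow> Pr A (\<lambda>w. \<not> P w) = 1 - Pr A P"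
  by (simp add: of_bool_not_iff)

lemma Pr_disj_le: "finite A \<Longrightarrow> Pr A (\<lambda>w. P w \<or> Q w) \<le> Pr A P + Pr A Q"
  using E_mono[of A "\<lambda>w. of_bool (P w \<or> Q w)" "\<lambda>w. of_bool (P w) + of_bool (Q w)"] by simp

lemma Pr_pos_of_fourth_moment:
  assumes "finite A" "0 \<le> E A D" "0 < E A (\<lambda>w. (D w)\<^sup>2)" "0 < \<kappa>"
    and D4: "E A (\<lambda>w. (D w)^4) \<le> \<kappa> * (E A (\<lambda>w. (D w)\<^sup>2))\<^sup>2"
  shows "27 / (80 * \<kappa>) \<le> Pr A (\<lambda>w. 0 < D w)"
proof -
  define m where "m = E A (\<lambda>w. (D w)\<^sup>2)"
  \<comment> \<open>This scaling maximises the lower bound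
    \<open>l\<^sup>2 * m - 4 / 27 * (l^4 * \<kappa> * m\<^sup>2)\<close>.\<close>
  define l where "l = sqrt (27 / (8 * \<kappa> * m))"
  have l: "0 < l" "l\<^sup>2 = 27 / (8 * \<kappa> * m)"
    using assms by (simp_all add: l_def m_def)
  have m: "0 < m" using assms(3) by (simp add: m_def)
  have "27 / (80 * \<kappa>) = (l\<^sup>2 * m - 4 / 27 * ((l\<^sup>2)\<^sup>2 * (\<kappa> * m\<^sup>2))) / 5"
    unfolding l(2) using m assms(4) by (simp add: field_simps power2_eq_square)
  also have "\<dots> \<le> (l * E A D + l\<^sup>2 * m - 4 / 27 * ((l\<^sup>2)\<^sup>2 * E A (\<lambda>w. (D w)^4))) / 5"
  proof -
    have "(l\<^sup>2)\<^sup>2 * E A (\<lambda>w. (D w)^4) \<le> (l\<^sup>2)\<^sup>2 * (\<kappa> * m\<^sup>2)"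
      using D4 by (intro mult_left_mono) (simp_all add: m_def)
    moreover have "0 \<le> l * E A D" using assms(2) l(1) by simp
    ultimately show ?thesis by (intro divide_right_mono) linarith+
  qed
  also have "\<dots> = E A (\<lambda>w. (l * D w + (l * D w)\<^sup>2 - 4 / 27 * (l * D w)^4) / 5)"
    using assms(1) by (simp add: m_def power_mult_distrib)
  also have "\<dots> \<le> E A (\<lambda>w. of_bool (0 < l * D w))"
    by (intro E_mono assms(1) of_bool_pos_ge)
  also have "\<dots> = Pr A (\<lambda>w. 0 < D w)"
    using l(1) by (simp add: zero_less_mult_iff)
  finally show ?thesis .
qed

text \<open>The Paley-Zygmund argument at level 0: dropping the negative part of \<open>D\<close>
  only increases the mean, and Cauchy-Schwarz separates \<open>D\<close> from the indicator.\<close>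

lemma Pr_pos_second_moment:
  assumes "finite A" "0 \<le> E A D"
  shows "(E A D)\<^sup>2 \<le> E A (\<lambda>w. (D w)\<^sup>2) * Pr A (\<lambda>w. 0 < D w)"
proof -
  have "E A D \<le> E A (\<lambda>w. D w * of_bool (0 < D w))"
    by (intro E_mono assms(1)) auto
  then have "(E A D)\<^sup>2 \<le> (E A (\<lambda>w. D w * of_bool (0 < D w)))\<^sup>2"
    using assms(2) by (intro power_mono)
  also have "\<dots> \<le> E A (\<lambda>w. (D w)\<^sup>2) * E A (\<lambda>w. (of_bool (0 < D w))\<^sup>2)"
    by (intro E_Cauchy_Schwarz assms(1))
  also have "(\<lambda>w. (of_bool (0 < D w))\<^sup>2 :: real) = (\<lambda>w. of_bool (0 < D w))"
    by auto
  finally show ?thesis .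
qed

section \<open>Concentration of signed sums\<close>

lemma sum_sg: "(\<Sum>i\<in>A. u i * sg (w i)) = \<mu> * (\<Sum>i\<in>A. u i) + (\<Sum>i\<in>A. u i * cs (w i))"
  unfolding sum_distrib_left sum.distrib[symmetric] cs_def
  by (intro sum.cong) (auto simp: algebra_simps)

lemma E_coordinate:
  assumes "finite A" "i \<in> A"
  shows "E A (\<lambda>w. f (w i)) = \<eta> * f True + (1 - \<eta>) * f False"
proof -
  have "E A (\<lambda>w. f (w i)) = measure_pmf.expectation (map_pmf (\<lambda>w. w i) (flips A)) f"
    by simp
  also have "map_pmf (\<lambda>w. w i) (flips A) = bernoulli_pmf \<eta>"
    using assms by (simp add: flips_def Pi_pmf_component)
  finally show ?thesis using eta_nonneg eta_le_1 by simp
qed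

lemma E_sg: "finite A \<Longrightarrow> i \<in> A \<Longrightarrow> E A (\<lambda>w. sg (w i)) = \<mu>"
  by (simp add: E_coordinate)

lemma Hoeffding_sg:
  assumes "finite A" and pos: "0 < \<mu> * (\<Sum>i\<in>A. u i)"
  shows "Pr A (\<lambda>w. (\<Sum>i\<in>A. u i * sg (w i)) \<le> 0) \<le> exp (- (\<mu> * (\<Sum>i\<in>A. u i))\<^sup>2 / (2 * (\<Sum>i\<in>A. (u i)\<^sup>2)))"
proof -
  define \<nu> where "\<nu> = (\<Sum>i\<in>A. E A (\<lambda>w. u i * sg (w i)))"
  have \<nu>: "\<nu> = \<mu> * (\<Sum>i\<in>A. u i)"
    using assms(1) by (simp add: \<nu>_def E_sg sum_distrib_left mult.commute[of \<mu>] flip: sum_distrib_right)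
  interpret Hoeffding_ineq "measure_pmf (flips A)" A "\<lambda>i w. u i * sg (w i)" "\<lambda>i. - \<bar>u i\<bar>" "\<lambda>i. \<bar>u i\<bar>" \<nu>
  proof unfold_locales
    have "prob_space.indep_vars (measure_pmf (flips A)) (\<lambda>_. count_space UNIV) (\<lambda>x f. f x) A"
      unfolding flips_def by (rule indep_vars_Pi_pmf) fact
    then show "prob_space.indep_vars (measure_pmf (flips A)) (\<lambda>_. borel) (\<lambda>i w. u i * sg (w i)) A"
      by (rule prob_space.indep_vars_compose2[OF measure_pmf.prob_space_axioms]) auto
    show "AE w in measure_pmf (flips A). u i * sg (w i) \<in> {- \<bar>u i\<bar>..\<bar>u i\<bar>}" for i
      by (auto simp: sg_def)
  qed (use assms(1) in \<open>auto simp: \<nu>_def\<close>)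
  have u: "0 < (\<Sum>i\<in>A. (u i)\<^sup>2)"
    using pos by (intro sum_squares_pos assms(1)) auto
  have sq: "(\<Sum>i\<in>A. (\<bar>u i\<bar> - - \<bar>u i\<bar>)\<^sup>2) = 4 * (\<Sum>i\<in>A. (u i)\<^sup>2)"
    by (simp add: sum_distrib_left power2_eq_square abs_mult_self_eq flip: power2_abs)
  \<comment> \<open>The deviation is chosen as the whole mean, so that the threshold is 0.\<close>
  have "measure_pmf.prob (flips A) {w. (\<Sum>i\<in>A. u i * sg (w i)) \<le> \<nu> - \<nu>}
      \<le> exp (- 2 * \<nu>\<^sup>2 / (4 * (\<Sum>i\<in>A. (u i)\<^sup>2)))"
    using Hoeffding_ineq_le[of \<nu>] u pos unfolding sq \<nu> by simp
  also have "- 2 * \<nu>\<^sup>2 / (4 * (\<Sum>i\<in>A. (u i)\<^sup>2)) = - \<nu>\<^sup>2 / (2 * (\<Sum>i\<in>A. (u i)\<^sup>2))"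
    by simp
  finally show ?thesis unfolding \<nu> by (simp add: prob_eq_E[symmetric])
qed

text \<open>Monotonicity for the product order on sign patterns in which coordinate \<open>i\<close>
  is reversed when \<open>s i\<close> is negative. One such \<open>s\<close> makes sums over
  different sets of samples increasing in common.\<close>

definition mono_wrt :: "('a \<Rightarrow> real) \<Rightarrow> (('a \<Rightarrow> bool) \<Rightarrow> real) \<Rightarrow> bool" where
  "mono_wrt s f \<longleftrightarrow> (\<forall>w w'. (\<forall>i. s i * sg (w i) \<le> s i * sg (w' i)) \<longrightarrow> f w \<le> f w')"

lemma mono_wrt_upd: "mono_wrt s f \<Longrightarrow> mono_wrt s (\<lambda>w. f (fun_upd w a b))"
  unfolding mono_wrt_def by (metis fun_upd_apply order_refl)

text \<open>By induction on the index set: given the flip at \<open>a\<close> the induction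
  hypothesis applies, and the conditional means of \<open>f\<close> and \<open>g\<close> move in the
  same direction with that flip.\<close>

lemma Harris_inequality:
  assumes "finite A" "mono_wrt s f" "mono_wrt s g"
  shows "E A f * E A g \<le> E A (\<lambda>w. f w * g w)"
  using assms
proof (induction A arbitrary: f g rule: finite_induct)
  case (insert a A)
  define f1 f0 g1 g0 where "f1 = E A (\<lambda>w. f (w(a := True)))" and "f0 = E A (\<lambda>w. f (w(a := False)))"
    and "g1 = E A (\<lambda>w. g (w(a := True)))" and "g0 = E A (\<lambda>w. g (w(a := False)))"
  have dir: "(0 \<le> s a \<longrightarrow> E A (\<lambda>w. h (w(a := True))) \<le> E A (\<lambda>w. h (w(a := False))))
      \<and> (\<not> 0 \<le> s a \<longrightarrow> E A (\<lambda>w. h (w(a := False))) \<le> E A (\<lambda>w. h (w(a := True))))" if "mono_wrt s h" for h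
  proof -
    have "h (w(a := True)) \<le> h (w(a := False))" if "0 \<le> s a" for w
      using \<open>mono_wrt s h\<close> that unfolding mono_wrt_def by (elim allE impE) auto
    moreover have "h (w(a := False)) \<le> h (w(a := True))" if "\<not> 0 \<le> s a" for w
      using \<open>mono_wrt s h\<close> that unfolding mono_wrt_def by (elim allE impE) auto
    ultimately show ?thesis using insert(1) by (auto intro!: E_mono)
  qed
  have "0 \<le> (f1 - f0) * (g1 - g0)"
    using dir[OF insert.prems(1)] dir[OF insert.prems(2)]
    unfolding f1_def f0_def g1_def g0_def
    by (cases "0 \<le> s a") (auto intro: mult_nonpos_nonpos mult_nonneg_nonneg simp del: fun_upd_apply)
  \<comment> \<open>This is the covariance of two functions of a single flip.\<close>
  then have "0 \<le> \<eta> * (1 - \<eta>) * ((f1 - f0) * (g1 - g0))"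
    using eta_nonneg eta_le_1 by simp
  also have "\<dots> = \<eta> * (f1 * g1) + (1 - \<eta>) * (f0 * g0) - (\<eta> * f1 + (1 - \<eta>) * f0) * (\<eta> * g1 + (1 - \<eta>) * g0)"
    by algebra
  finally have "(\<eta> * f1 + (1 - \<eta>) * f0) * (\<eta> * g1 + (1 - \<eta>) * g0) \<le> \<eta> * (f1 * g1) + (1 - \<eta>) * (f0 * g0)"
    by simp
  also have "\<dots> \<le> \<eta> * E A (\<lambda>w. f (w(a := True)) * g (w(a := True)))
      + (1 - \<eta>) * E A (\<lambda>w. f (w(a := False)) * g (w(a := False)))"
    unfolding f1_def f0_def g1_def g0_def using eta_nonneg eta_le_1 insert.prems
    by (intro add_mono mult_left_mono insert.IH mono_wrt_upd) auto
  finally show ?case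
    using insert(1,2) by (simp add: E_insert f1_def f0_def g1_def g0_def)
qed (simp add: E_empty)

lemma Harris_Pr:
  assumes "finite A" "mono_wrt s (\<lambda>w. of_bool (P w))" "mono_wrt s (\<lambda>w. of_bool (Q w))"
  shows "Pr A P * Pr A Q \<le> Pr A (\<lambda>w. P w \<and> Q w)"
  using Harris_inequality[OF assms] by (simp add: of_bool_conj)

lemma mono_wrt_conj:
  "mono_wrt s (\<lambda>w. of_bool (P w)) \<Longrightarrow> mono_wrt s (\<lambda>w. of_bool (Q w)) \<Longrightarrow> mono_wrt s (\<lambda>w. of_bool (P w \<and> Q w))"
  unfolding mono_wrt_def by (simp add: of_bool_def split: if_splits) (metis not_one_le_zero)+

lemma mono_wrt_sum_pos: "mono_wrt s (\<lambda>w. of_bool (0 < (\<Sum>i\<in>B. s i * sg (w i))))"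
  unfolding mono_wrt_def
  by (auto simp: of_bool_def dest: less_le_trans intro: sum_mono) (meson less_le_trans sum_mono)

lemma mono_wrt_sum_nonneg: "mono_wrt s (\<lambda>w. of_bool (0 \<le> (\<Sum>i\<in>B. s i * sg (w i))))"
  unfolding mono_wrt_def
  by (auto simp: of_bool_def) (meson order_trans sum_mono)

text \<open>Swapping the two classes is a symmetry of the noise that negates the sum.\<close>
lemma Pr_balanced_nonneg:
  assumes "finite A" "B \<subseteq> A" "C \<subseteq> A" "B \<inter> C = {}" "card B = card C"
    and B: "\<And>i. i \<in> B \<Longrightarrow> s i = 1" and C: "\<And>i. i \<in> C \<Longrightarrow> s i = - 1"
  shows "1 / 2 \<le> Pr A (\<lambda>w. 0 \<le> (\<Sum>i\<in>B \<union> C. s i * sg (w i)))"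
proof -
  have fin: "finite B" "finite C" using assms(1-3) finite_subset by auto
  obtain h where h: "bij_betw h B C"
    using fin assms(5) finite_same_card_bij by blast
  define k where "k i = (if i \<in> B then h i else if i \<in> C then inv_into B h i else i)" for i
  have kB: "bij_betw k B C"
    using h by (rule bij_betw_cong[THEN iffD1, rotated]) (simp add: k_def)
  have kC: "bij_betw k C B"
    using bij_betw_inv_into[OF h]
    by (rule bij_betw_cong[THEN iffD1, rotated]) (use assms(4) in \<open>auto simp: k_def\<close>)
  have kR: "bij_betw k (A - (B \<union> C)) (A - (B \<union> C))"
    using bij_betw_id by (rule bij_betw_cong[THEN iffD1, rotated]) (auto simp: k_def)
  have "bij_betw k (B \<union> C) (C \<union> B)"
    using kB kC by (rule bij_betw_combine) (use assms(4) in auto)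
  then have "bij_betw k ((B \<union> C) \<union> (A - (B \<union> C))) ((C \<union> B) \<union> (A - (B \<union> C)))"
    using kR by (rule bij_betw_combine) auto
  moreover have "(B \<union> C) \<union> (A - (B \<union> C)) = A" "(C \<union> B) \<union> (A - (B \<union> C)) = A"
    using assms(2,3) by auto
  ultimately have "bij_betw k A A" by simp
  then have flips: "flips A = map_pmf (\<lambda>g. g \<circ> k) (flips A)"
    unfolding flips_def
    by (rule Pi_pmf_bij_betw[OF assms(1)]) (use assms(2,3) in \<open>auto simp: k_def\<close>)
  define X where "X = (\<lambda>w. \<Sum>i\<in>B \<union> C. s i * sg (w i))"
  have X: "X w = (\<Sum>i\<in>B. sg (w i)) - (\<Sum>i\<in>C. sg (w i))" for w
    unfolding X_def using fin assms(4) B C by (subst sum.union_disjoint) (auto simp: sum_negf)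
  have neg: "X (w \<circ> k) = - X w" for w
    using sum.reindex_bij_betw[OF kB, of "\<lambda>i. sg (w i)"] sum.reindex_bij_betw[OF kC, of "\<lambda>i. sg (w i)"]
    by (simp add: X)
  have "Pr A (\<lambda>w. 0 \<le> X w) = measure_pmf.expectation (map_pmf (\<lambda>g. g \<circ> k) (flips A)) (\<lambda>w. of_bool (0 \<le> X w))"
    using flips by simp
  also have "\<dots> = Pr A (\<lambda>w. X w \<le> 0)"
    by (simp add: neg)
  \<comment> \<open>The events \<open>0 \<le> X w\<close> and \<open>X w \<le> 0\<close> are equally
    likely and together exhaust all outcomes.\<close>
  finally have "2 * Pr A (\<lambda>w. 0 \<le> X w) = E A (\<lambda>w. of_bool (0 \<le> X w) + of_bool (X w \<le> 0))"
    using assms(1) by simp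
  moreover have "E A (\<lambda>w. 1) \<le> \<dots>"
    by (intro E_mono assms(1)) auto
  ultimately show ?thesis by (simp add: X_def)
qed

text \<open>The average of the signs over \<open>D\<close> is at most 1 and is nonpositive off the
  event, so it lies below the indicator. Its mean is \<open>\<mu>\<close>, which is at least 1/2
  here.\<close>

lemma Pr_majority:
  assumes "finite A" "D \<subseteq> A" "D \<noteq> {}" "\<eta> \<le> 1 / 4" and D: "\<And>i. i \<in> D \<Longrightarrow> s i = 1"
  shows "1 / 2 \<le> Pr A (\<lambda>w. 0 < (\<Sum>i\<in>D. s i * sg (w i)))"
proof -
  have fin: "finite D" using assms(1,2) finite_subset by auto
  then have n: "0 < real (card D)" using assms(3) by (simp add: card_gt_0_iff)
  have sum: "(\<Sum>i\<in>D. s i * sg (w i)) = (\<Sum>i\<in>D. sg (w i))" for w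
    using D by simp
  have "1 / 2 \<le> \<mu>" using assms(4) by simp
  also have "\<mu> = (\<Sum>i\<in>D. E A (\<lambda>w. sg (w i))) / real (card D)"
    using assms(1,2) n by (simp add: E_sg subset_iff)
  also have "\<dots> = E A (\<lambda>w. (\<Sum>i\<in>D. sg (w i)) / real (card D))"
    using assms(1) by simp
  also have "\<dots> \<le> Pr A (\<lambda>w. 0 < (\<Sum>i\<in>D. sg (w i)))"
  proof (intro E_mono assms(1))
    fix w
    have "(\<Sum>i\<in>D. sg (w i)) \<le> (\<Sum>i\<in>D. 1)" by (intro sum_mono) (simp add: sg_def)
    then have "(\<Sum>i\<in>D. sg (w i)) / real (card D) \<le> 1" using n by simp
    then show "(\<Sum>i\<in>D. sg (w i)) / real (card D) \<le> of_bool (0 < (\<Sum>i\<in>D. sg (w i)))"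
      using n by (simp add: of_bool_def divide_nonpos_pos)
  qed
  finally show ?thesis by (simp add: sum)
qed

text \<open>For \<open>\<eta> \<le> 1 / 4\<close> the negative \<open>s i\<close> are paired with as
  many positive ones, the remaining ones are all positive, and Harris' inequality combines the two
  parts. For larger rates below 1/2 the centred sum is already positive with constant probability,
  and the mean is positive.\<close>

lemma Pr_sign_sum_pos:
  assumes "finite A" "B \<subseteq> A" "\<eta> < 1 / 2" and s: "\<And>i. i \<in> B \<Longrightarrow> s i = 1 \<or> s i = - 1"
    and pos: "0 < (\<Sum>i\<in>B. s i)"
  shows "1 / 80 \<le> Pr A (\<lambda>w. 0 < (\<Sum>i\<in>B. s i * sg (w i)))"
proof (cases "\<eta> \<le> 1 / 4")
  case True
  define P N where "P = {i \<in> B. s i = 1}" and "N = {i \<in> B. s i = - 1}"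
  have fin: "finite P" "finite N" and sub: "P \<subseteq> A" "N \<subseteq> A" and dis: "P \<inter> N = {}" and B: "B = P \<union> N"
    using assms(1,2) s by (auto simp: P_def N_def intro: finite_subset)
  have "(\<Sum>i\<in>B. s i) = (\<Sum>i\<in>P. s i) + (\<Sum>i\<in>N. s i)"
    unfolding B by (rule sum.union_disjoint) fact+
  also have "(\<Sum>i\<in>P. s i) = card P" by (simp add: P_def)
  also have "(\<Sum>i\<in>N. s i) = - card N" by (simp add: N_def)
  finally have "card N < card P" using pos by simp
  then obtain P' where P': "P' \<subseteq> P" "card P' = card N" "finite P'"
    using obtain_subset_with_card_n[of "card N" P] by auto
  define D where "D = P - P'"
  have D: "D \<noteq> {}" "D \<subseteq> A"
    using P' \<open>card N < card P\<close> sub by (auto simp: D_def)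
  have "1 / 2 * (1 / 2) \<le> Pr A (\<lambda>w. 0 < (\<Sum>i\<in>D. s i * sg (w i))) * Pr A (\<lambda>w. 0 \<le> (\<Sum>i\<in>P' \<union> N. s i * sg (w i)))"
    using assms(1) D P' sub True dis
    by (intro mult_mono Pr_majority Pr_balanced_nonneg) (auto simp: D_def P_def N_def intro!: E_nonneg)
  also have "\<dots> \<le> Pr A (\<lambda>w. 0 < (\<Sum>i\<in>D. s i * sg (w i)) \<and> 0 \<le> (\<Sum>i\<in>P' \<union> N. s i * sg (w i)))"
    by (intro Harris_Pr[where s = s] assms(1) mono_wrt_sum_pos mono_wrt_sum_nonneg)
  also have "\<dots> \<le> Pr A (\<lambda>w. 0 < (\<Sum>i\<in>B. s i * sg (w i)))"
  proof (intro Pr_mono assms(1))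
    fix w
    have "B = D \<union> (P' \<union> N)" using P' by (auto simp: B D_def)
    moreover have "D \<inter> (P' \<union> N) = {}" using dis by (auto simp: D_def)
    ultimately have "(\<Sum>i\<in>B. s i * sg (w i)) = (\<Sum>i\<in>D. s i * sg (w i)) + (\<Sum>i\<in>P' \<union> N. s i * sg (w i))"
      using fin P' by (simp add: sum.union_disjoint D_def)
    then show "0 < (\<Sum>i\<in>D. s i * sg (w i)) \<and> 0 \<le> (\<Sum>i\<in>P' \<union> N. s i * sg (w i)) \<Longrightarrow> 0 < (\<Sum>i\<in>B. s i * sg (w i))"
      by simp
  qed
  finally show ?thesis by simp
next
  case False
  define u where "u i = (if i \<in> B then s i else 0)" for i
  define X where "X = (\<lambda>w. \<Sum>i\<in>A. u i * cs (w i))"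
  have V: "3 / 4 \<le> V"
  proof -
    have "0 \<le> (\<eta> - 1 / 4) * (1 / 2 - \<eta>)" "0 \<le> \<eta> - 1 / 4"
      using False assms(3) by auto
    then show ?thesis by (simp add: algebra_simps)
  qed
  obtain i where "i \<in> B" using pos by (metis sum.empty less_irrefl ex_in_conv)
  then have "0 < (\<Sum>i\<in>A. (u i)\<^sup>2)"
    using assms(1,2) s[of i] by (intro sum_pos2[of A i]) (auto simp: u_def)
  moreover have "0 < V" using V by linarith
  ultimately have "0 < V * (\<Sum>i\<in>A. (u i)\<^sup>2)" by (rule mult_pos_pos[rotated])
  then have "0 < E A (\<lambda>w. (X w)\<^sup>2)"
    unfolding X_def E_sum_cs_square[OF assms(1)] .
  moreover have "E A X = 0" unfolding X_def by (rule E_sum_cs) fact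
  moreover have "E A (\<lambda>w. (X w)^4) \<le> 25 * (E A (\<lambda>w. (X w)\<^sup>2))\<^sup>2"
    using fourth_moment_affine[OF assms(1) V, of 0 u] by (simp add: X_def)
  \<comment> \<open>This value, 27/2000, is slightly above 1/80 and determines the constant of the
    lemma.\<close>
  ultimately have "27 / (80 * 25) \<le> Pr A (\<lambda>w. 0 < X w)"
    using assms(1) by (intro Pr_pos_of_fourth_moment) auto
  also have "\<dots> \<le> Pr A (\<lambda>w. 0 < (\<Sum>i\<in>B. s i * sg (w i)))"
  proof (intro Pr_mono assms(1))
    fix w
    have "X w = (\<Sum>i\<in>B. s i * cs (w i))"
      unfolding X_def using assms(1,2) by (intro sum.mono_neutral_cong_right) (auto simp: u_def)
    also have "\<dots> = (\<Sum>i\<in>B. s i * sg (w i)) - \<mu> * (\<Sum>i\<in>B. s i)"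
      by (simp add: sum_sg)
    finally show "0 < X w \<Longrightarrow> 0 < (\<Sum>i\<in>B. s i * sg (w i))"
      using mult_pos_pos[of \<mu>, OF _ pos] assms(3) by linarith
  qed
  finally show ?thesis by simp
qed

end

section \<open>Failure probabilities of products and of four sums\<close>

text \<open>The constant of the theorem: \<open>80^4\<close> comes from four events of probability
  at least 1/80 each, and 32 is the value of \<open>t\<close> from which the exponential tail takes
  over.\<close>

definition rate :: real where
  "rate = 32 * 80^4"

lemma rate_pos: "0 < rate"
  by (simp add: rate_def)

text \<open>For \<open>t\<close> at least 32, half of the exponent absorbs the factor 4, since
  \<open>4 \<le> exp 2\<close>. For smaller \<open>t\<close>, \<open>1 - z \<le> exp (- z)\<close>
  turns the success probability into an exponential, and
  \<open>t / 32 \<le> min 1 t\<close>.\<close>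

lemma exp_tail_combine:
  fixes t F :: real
  assumes "0 \<le> t" and large: "F \<le> 4 * exp (- (t / 8))" and small: "F \<le> 1 - min 1 t / 80^4"
  shows "F \<le> exp (- (t / rate))"
proof (cases "32 \<le> t")
  case True
  have "2 \<le> exp (1 :: real)" using exp_ge_add_one_self[of "1 :: real"] by simp
  then have "2 * 2 \<le> exp (1 :: real) * exp 1" by (intro mult_mono) auto
  then have "4 \<le> exp (2 :: real)" by (simp flip: exp_add)
  also have "\<dots> \<le> exp (t / 16)" using True by simp
  finally have "4 * exp (- (t / 8)) \<le> exp (t / 16) * exp (- (t / 8))"
    by (intro mult_right_mono) auto
  also have "\<dots> = exp (- (t / 16))" by (simp flip: exp_add)
  also have "\<dots> \<le> exp (- (t / rate))" using assms(1) by (simp add: rate_def)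
  finally show ?thesis using large by simp
next
  case False
  have "t / rate \<le> min 1 t / 80^4" using False assms(1) by (simp add: rate_def)
  have "1 - min 1 t / 80^4 \<le> exp (- (min 1 t / 80^4))"
    using exp_ge_add_one_self[of "- (min 1 t / 80^4)"] by simp
  also have "\<dots> \<le> exp (- (t / rate))" using \<open>t / rate \<le> _\<close> by simp
  finally show ?thesis using small by simp
qed

text \<open>\<open>X\<close> and \<open>Y\<close> will be the squares of \<open>U\<close> and
  \<open>W\<close>, and \<open>11 * n\<close> accounts for the fluctuations. If one of them is at
  most \<open>n\<close>, the denominator is at most \<open>180 * n^3\<close>; otherwise both
  dominate \<open>n\<close> and the ratio is at least 1/144.\<close>

lemma second_moment_ratio:
  fixes n X Y :: real
  assumes "1 \<le> n" "0 \<le> X" "0 \<le> Y" "X \<le> 4 * n\<^sup>2" "Y \<le> 4 * n\<^sup>2"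
  shows "min 1 (X * Y / n^3) / 180 \<le> X * Y / ((X + 11 * n) * (Y + 11 * n))"
proof -
  have *: "X * Y / n^3 / 180 \<le> X * Y / ((X + 11 * n) * (Y + 11 * n))"
    if "0 \<le> X" "0 \<le> Y" "X \<le> n" "Y \<le> 4 * n\<^sup>2" for X Y
  proof -
    have "n * 1 \<le> n * n" using assms(1) by (intro mult_left_mono) auto
    then have "Y + 11 * n \<le> 15 * n\<^sup>2" using that(4) by (simp add: power2_eq_square)
    then have "(X + 11 * n) * (Y + 11 * n) \<le> (12 * n) * (15 * n\<^sup>2)"
      using that assms(1) by (intro mult_mono) auto
    also have "\<dots> = n^3 * 180" by (simp add: power3_eq_cube power2_eq_square)
    finally have "X * Y / (n^3 * 180) \<le> X * Y / ((X + 11 * n) * (Y + 11 * n))"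
      using that assms(1) by (intro divide_left_mono mult_pos_pos add_nonneg_pos) auto
    then show ?thesis by simp
  qed
  consider "X \<le> n" | "Y \<le> n" | "n < X" "n < Y" by linarith
  then show ?thesis
  proof cases
    case 1
    have "min 1 (X * Y / n^3) / 180 \<le> X * Y / n^3 / 180" by (intro divide_right_mono) auto
    also have "\<dots> \<le> X * Y / ((X + 11 * n) * (Y + 11 * n))" using 1 assms by (intro *)
    finally show ?thesis .
  next
    case 2
    have "min 1 (X * Y / n^3) / 180 \<le> Y * X / n^3 / 180" by (intro divide_right_mono) (auto simp: mult.commute)
    also have "\<dots> \<le> Y * X / ((Y + 11 * n) * (X + 11 * n))" using 2 assms by (intro *)
    finally show ?thesis by (simp add: mult.commute)
  next
    case 3
    have "(X + 11 * n) * (Y + 11 * n) \<le> (12 * X) * (12 * Y)"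
      using 3 assms by (intro mult_mono) auto
    then have "1 / 144 \<le> X * Y / ((X + 11 * n) * (Y + 11 * n))"
      using 3 assms by (simp add: field_simps add_pos_pos)
    moreover have "min 1 (X * Y / n^3) / 180 \<le> 1 / 180" by (intro divide_right_mono) auto
    ultimately show ?thesis by simp
  qed
qed

context flip_rate
begin

lemma E_square_le_second: "finite A \<Longrightarrow> (E A f)\<^sup>2 \<le> E A (\<lambda>w. (f w)\<^sup>2)"
  using E_Cauchy_Schwarz[of A f "\<lambda>_. 1"] by simp

text \<open>Mean and fluctuation are separated by \<open>(x + z)^4 \<le> 8 * (x^4 + z^4)\<close>.
  The constant 11 is due to \<open>7 * 16 \<le> 11\<^sup>2\<close>.\<close>

lemma E_sum_sg_fourth:
  assumes "finite A" "(\<Sum>i\<in>A. (u i)\<^sup>2) \<le> 4 * n"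
  shows "E A (\<lambda>w. (\<Sum>i\<in>A. u i * sg (w i))^4) \<le> 8 * ((\<Sum>i\<in>A. u i)\<^sup>2 + 11 * n)\<^sup>2"
proof -
  define U s where "U = (\<Sum>i\<in>A. u i)" and "s = (\<Sum>i\<in>A. (u i)\<^sup>2)"
  have s: "0 \<le> s" "s \<le> 4 * n" using assms by (auto simp: s_def intro: sum_nonneg)
  have pt: "(x + z)^4 \<le> 8 * (x^4 + z^4)" for x z :: real
  proof -
    have "(x + z)\<^sup>2 \<le> 2 * (x\<^sup>2 + z\<^sup>2)"
      using zero_le_power2[of "x - z"] by (simp add: power2_eq_square algebra_simps)
    then have "((x + z)\<^sup>2)\<^sup>2 \<le> (2 * (x\<^sup>2 + z\<^sup>2))\<^sup>2" by (intro power_mono) auto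
    moreover have "(2 * (x\<^sup>2 + z\<^sup>2))\<^sup>2 = 8 * (x^4 + z^4) - 4 * (x\<^sup>2 - z\<^sup>2)\<^sup>2" by algebra
    moreover have "((x + z)\<^sup>2)\<^sup>2 = (x + z)^4" by simp
    ultimately show ?thesis using zero_le_power2[of "x\<^sup>2 - z\<^sup>2"] by linarith
  qed
  have "\<bar>\<mu>\<bar>^4 \<le> 1" using eta_nonneg eta_le_1 by (intro power_le_one) auto
  then have "(\<mu> * U)^4 \<le> 1 * U^4"
    unfolding power_mult_distrib by (intro mult_right_mono) auto
  have "E A (\<lambda>w. (\<Sum>i\<in>A. u i * sg (w i))^4) \<le> E A (\<lambda>w. 8 * ((\<mu> * U)^4 + (\<Sum>i\<in>A. u i * cs (w i))^4))"
    unfolding sum_sg U_def by (intro E_mono assms(1) pt)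
  also have "\<dots> = 8 * ((\<mu> * U)^4 + E A (\<lambda>w. (\<Sum>i\<in>A. u i * cs (w i))^4))"
    using assms(1) by simp
  also have "\<dots> \<le> 8 * (U^4 + 7 * s\<^sup>2)"
    using fourth_moment_linear[OF assms(1), of u] \<open>(\<mu> * U)^4 \<le> 1 * U^4\<close> unfolding s_def by (intro mult_left_mono add_mono) auto
  also have "\<dots> \<le> 8 * (U\<^sup>2 + 11 * n)\<^sup>2"
  proof -
    have "s\<^sup>2 \<le> 16 * n\<^sup>2" using power_mono[OF s(2,1), of 2] by (simp add: power_mult_distrib)
    moreover have sq: "(U\<^sup>2 + 11 * n)\<^sup>2 = U^4 + 22 * (U\<^sup>2 * n) + 121 * n\<^sup>2" by algebra
    moreover have "0 \<le> U\<^sup>2 * n" "0 \<le> n\<^sup>2" using s by auto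
    ultimately have "U^4 + 7 * s\<^sup>2 \<le> (U\<^sup>2 + 11 * n)\<^sup>2" unfolding sq by linarith
    then show ?thesis by simp
  qed
  finally show ?thesis by (simp add: U_def)
qed

text \<open>Centring both factors turns the product into a quadratic polynomial in the centred
  signs. Its mean is at least \<open>\<mu>\<^sup>2 * U * W\<close>, because \<open>uv\<close> makes
  the covariance term nonnegative.\<close>

lemma Pr_product_pos_lower:
  fixes A :: "'a set" and u v :: "'a \<Rightarrow> real" and n \<rho> :: real
  defines "U \<equiv> \<Sum>i\<in>A. u i" and "W \<equiv> \<Sum>i\<in>A. v i"
  assumes "finite A" "\<eta> \<noteq> 1 / 2" "1 \<le> n"
    and uv: "0 \<le> (\<Sum>i\<in>A. u i * v i)"
    and u2: "(\<Sum>i\<in>A. (u i)\<^sup>2) \<le> 4 * n" and v2: "(\<Sum>i\<in>A. (v i)\<^sup>2) \<le> 4 * n"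
    and U: "\<bar>U\<bar> \<le> 2 * n" and W: "\<bar>W\<bar> \<le> 2 * n" and "0 < \<rho>" and UW: "2 * n\<^sup>2 * \<rho> \<le> U * W"
  shows "min 1 (n * \<mu>\<^sup>2 * \<rho>\<^sup>2) / 80^4 \<le> Pr A (\<lambda>w. 0 < (\<Sum>i\<in>A. u i * sg (w i)) * (\<Sum>i\<in>A. v i * sg (w i)))"
proof -
  define D where "D = (\<lambda>w. (\<Sum>i\<in>A. u i * sg (w i)) * (\<Sum>i\<in>A. v i * sg (w i)))"
  define l where "l i = \<mu> * (U * v i + W * u i)" for i
  have D: "D w = \<mu>\<^sup>2 * U * W + (\<Sum>i\<in>A. l i * cs (w i)) + (\<Sum>i\<in>A. u i * cs (w i)) * (\<Sum>i\<in>A. v i * cs (w i))" for w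
  proof -
    have "(\<Sum>i\<in>A. l i * cs (w i)) = \<mu> * U * (\<Sum>i\<in>A. v i * cs (w i)) + \<mu> * W * (\<Sum>i\<in>A. u i * cs (w i))"
      unfolding l_def sum_distrib_left sum.distrib[symmetric] by (intro sum.cong) (auto simp: algebra_simps)
    moreover have "(m * p + a) * (m * q + b) = m\<^sup>2 * p * q + (m * p * b + m * q * a) + a * b" for m p q a b :: real
      by algebra
    ultimately show ?thesis
      unfolding D_def sum_sg U_def[symmetric] W_def[symmetric] by (simp only:)
  qed
  have "0 < 2 * n\<^sup>2 * \<rho>" using assms by simp
  then have UW_pos: "0 < U * W" using UW by linarith
  have "0 < \<mu>\<^sup>2" using assms(4) by simp
  have ED_eq: "E A D = \<mu>\<^sup>2 * U * W + V * (\<Sum>i\<in>A. u i * v i)"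
    unfolding D by (rule E_quadratic) fact
  moreover have "0 \<le> V * (\<Sum>i\<in>A. u i * v i)" using uv V_bounds by simp
  ultimately have ED: "\<mu>\<^sup>2 * (U * W) \<le> E A D" by (simp add: mult.assoc)
  then have ED_pos: "0 < E A D" using mult_pos_pos[OF \<open>0 < \<mu>\<^sup>2\<close> UW_pos] by linarith
  have "0 < (E A D)\<^sup>2" using ED_pos by simp
  then have ED2: "0 < E A (\<lambda>w. (D w)\<^sup>2)"
    using E_square_le_second[OF assms(3), of D] by linarith
  have "min 1 (n * \<mu>\<^sup>2 * \<rho>\<^sup>2) / 80^4 \<le> Pr A (\<lambda>w. 0 < D w)"
  \<comment> \<open>\<open>\<mu>\<^sup>2 \<le> 1 / 4\<close> is the same as
    \<open>3 / 4 \<le> V\<close>, the range of the hypercontractive bound.\<close>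
  proof (cases "\<mu>\<^sup>2 \<le> 1 / 4")
    case True
    have V: "3 / 4 \<le> V" using True by (simp add: power2_eq_square algebra_simps)
    have "E A (\<lambda>w. (D w)^4) \<le> 625 * (E A (\<lambda>w. (D w)\<^sup>2))\<^sup>2"
      unfolding D by (intro fourth_moment_quadratic assms(3) V)
    then have "27 / (80 * 625) \<le> Pr A (\<lambda>w. 0 < D w)"
      using ED_pos ED2 by (intro Pr_pos_of_fourth_moment assms(3)) auto
    moreover have "min 1 (n * \<mu>\<^sup>2 * \<rho>\<^sup>2) / 80^4 \<le> 1 / 80^4" by (intro divide_right_mono) auto
    ultimately show ?thesis by simp
  next
    case False
    \<comment> \<open>\<open>8 * P\<^sup>2\<close> and \<open>8 * Q\<^sup>2\<close> bound the fourth
      moments of the two factors, so Cauchy-Schwarz bounds the second moment of \<open>D\<close> by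
      \<open>8 * (P * Q)\<close>.\<close>
    define P Q where "P = U\<^sup>2 + 11 * n" and "Q = W\<^sup>2 + 11 * n"
    have PQ: "0 < P" "0 < Q" using assms(5) by (auto simp: P_def Q_def intro: add_nonneg_pos)
    have "E A (\<lambda>w. (D w)\<^sup>2) \<le> 8 * (P * Q)"
    proof (rule power2_le_imp_le)
      have "(E A (\<lambda>w. (D w)\<^sup>2))\<^sup>2 \<le> E A (\<lambda>w. ((\<Sum>i\<in>A. u i * sg (w i))\<^sup>2)\<^sup>2) * E A (\<lambda>w. ((\<Sum>i\<in>A. v i * sg (w i))\<^sup>2)\<^sup>2)"
        unfolding D_def power_mult_distrib by (rule E_Cauchy_Schwarz) fact
      also have "\<dots> \<le> (8 * P\<^sup>2) * (8 * Q\<^sup>2)"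
        using E_sum_sg_fourth[OF assms(3) u2] E_sum_sg_fourth[OF assms(3) v2]
        by (intro mult_mono) (auto simp: P_def Q_def U_def W_def intro!: E_nonneg)
      finally show "(E A (\<lambda>w. (D w)\<^sup>2))\<^sup>2 \<le> (8 * (P * Q))\<^sup>2" by (simp add: power_mult_distrib)
    qed (use PQ in simp)
    have "1 / 4 * (U * W) \<le> \<mu>\<^sup>2 * (U * W)" using False UW_pos by (intro mult_right_mono) auto
    then have "(1 / 4 * (U * W))\<^sup>2 \<le> (E A D)\<^sup>2" using ED UW_pos by (intro power_mono) linarith+
    also have "\<dots> \<le> E A (\<lambda>w. (D w)\<^sup>2) * Pr A (\<lambda>w. 0 < D w)"
      using ED_pos by (intro Pr_pos_second_moment assms(3)) simp
    also have "\<dots> \<le> 8 * (P * Q) * Pr A (\<lambda>w. 0 < D w)"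
      by (intro mult_right_mono E_nonneg) (fact, simp)
    finally have main_raw: "(1 / 4 * (U * W))\<^sup>2 \<le> 8 * (P * Q) * Pr A (\<lambda>w. 0 < D w)" .
    have main: "U\<^sup>2 * W\<^sup>2 / (P * Q) / 128 \<le> Pr A (\<lambda>w. 0 < D w)"
    proof -
      note main_raw
      moreover have "(1 / 4 * (U * W))\<^sup>2 = U\<^sup>2 * W\<^sup>2 / 16"
        by (simp add: power_mult_distrib power_divide)
      ultimately have "U\<^sup>2 * W\<^sup>2 / 16 \<le> 8 * (P * Q) * Pr A (\<lambda>w. 0 < D w)" by (simp only:)
      moreover have "z / 16 \<le> 8 * c * p \<Longrightarrow> z / 128 \<le> p * c" for z c p :: real
        by (simp add: field_simps)
      ultimately have "U\<^sup>2 * W\<^sup>2 / 128 \<le> Pr A (\<lambda>w. 0 < D w) * (P * Q)" by blast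
      moreover have "0 < P * Q" using PQ by simp
      ultimately have "U\<^sup>2 * W\<^sup>2 / 128 / (P * Q) \<le> Pr A (\<lambda>w. 0 < D w)"
        by (simp only: pos_divide_le_eq)
      then show ?thesis by (simp only: divide_divide_eq_left mult.commute)
    qed
    \<comment> \<open>Squaring \<open>UW\<close> gives the order
      \<open>n^4 * \<rho>\<^sup>2\<close>; the division by \<open>n^3\<close> leaves the single
      factor \<open>n\<close> of the exponent.\<close>
    have t_le: "n * \<mu>\<^sup>2 * \<rho>\<^sup>2 \<le> U\<^sup>2 * W\<^sup>2 / n^3"
    proof -
      have "(2 * n\<^sup>2 * \<rho>)\<^sup>2 \<le> (U * W)\<^sup>2" using UW \<open>0 < 2 * n\<^sup>2 * \<rho>\<close> by (intro power_mono) auto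
      then have "4 * (n^4 * \<rho>\<^sup>2) \<le> U\<^sup>2 * W\<^sup>2" by (simp add: power_mult_distrib)
      moreover have "n^4 * \<rho>\<^sup>2 * \<mu>\<^sup>2 \<le> n^4 * \<rho>\<^sup>2 * 1"
        using eta_nonneg eta_le_1 by (intro mult_left_mono) (auto simp: abs_square_le_1)
      moreover have "0 \<le> n^4 * \<rho>\<^sup>2" by simp
      ultimately have "n^4 * \<rho>\<^sup>2 * \<mu>\<^sup>2 \<le> U\<^sup>2 * W\<^sup>2" by linarith
      moreover have "n * \<mu>\<^sup>2 * \<rho>\<^sup>2 * n^3 = n^4 * \<rho>\<^sup>2 * \<mu>\<^sup>2" by algebra
      moreover have "0 < n^3" using assms(5) by simp
      ultimately show ?thesis by (simp only: pos_le_divide_eq)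
    qed
    have "min 1 (n * \<mu>\<^sup>2 * \<rho>\<^sup>2) / 80^4 \<le> min 1 (U\<^sup>2 * W\<^sup>2 / n^3) / 180 / 128"
    proof -
      define X where "X = U\<^sup>2 * W\<^sup>2 / n^3"
      have "min 1 (n * \<mu>\<^sup>2 * \<rho>\<^sup>2) \<le> min 1 X" using t_le by (auto simp: X_def)
      then have "min 1 (n * \<mu>\<^sup>2 * \<rho>\<^sup>2) / 80^4 \<le> min 1 X / 80^4"
        by (intro divide_right_mono) auto
      also have "\<dots> \<le> min 1 X / (180 * 128)"
        using assms(5) by (intro divide_left_mono) (auto simp: X_def)
      finally show ?thesis by (simp only: X_def divide_divide_eq_left)
    qed
    also have "\<dots> \<le> U\<^sup>2 * W\<^sup>2 / (P * Q) / 128"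
    proof -
      have "U\<^sup>2 \<le> 4 * n\<^sup>2" "W\<^sup>2 \<le> 4 * n\<^sup>2"
        using power_mono[OF U, of 2] power_mono[OF W, of 2] by (simp_all add: power_mult_distrib)
      then show ?thesis
        unfolding P_def Q_def using assms(5) by (intro divide_right_mono second_moment_ratio) auto
    qed
    finally show ?thesis using main by linarith
  qed
  then show ?thesis by (simp add: D_def)
qed

text \<open>Hoeffding's exponent for weights of squared norm at most \<open>4 * n\<close>: the 8 in
  the bound is 2 times this 4.\<close>

lemma Hoeffding_sg_margin:
  assumes "finite A" "0 < n" "0 \<le> \<rho>" and pos: "0 < \<mu> * (\<Sum>i\<in>A. a i)"
    and a2: "(\<Sum>i\<in>A. (a i)\<^sup>2) \<le> 4 * n" and margin: "n * \<rho> \<le> \<bar>\<Sum>i\<in>A. a i\<bar>"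
  shows "Pr A (\<lambda>w. (\<Sum>i\<in>A. a i * sg (w i)) \<le> 0) \<le> exp (- (n * \<mu>\<^sup>2 * \<rho>\<^sup>2 / 8))"
proof -
  have a2_pos: "0 < (\<Sum>i\<in>A. (a i)\<^sup>2)"
    using pos by (intro sum_squares_pos assms(1)) auto
  have "(n * \<rho>)\<^sup>2 \<le> (\<Sum>i\<in>A. a i)\<^sup>2"
    using margin assms(2,3) by (subst power2_abs[symmetric]) (intro power_mono, auto)
  then have "\<mu>\<^sup>2 * (n * \<rho>)\<^sup>2 \<le> (\<mu> * (\<Sum>i\<in>A. a i))\<^sup>2"
    unfolding power_mult_distrib[of \<mu>] by (intro mult_left_mono) auto
  then have "\<mu>\<^sup>2 * (n * \<rho>)\<^sup>2 / (8 * n) \<le> (\<mu> * (\<Sum>i\<in>A. a i))\<^sup>2 / (2 * (\<Sum>i\<in>A. (a i)\<^sup>2))"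
    using a2 a2_pos by (intro frac_le) auto
  moreover have "\<mu>\<^sup>2 * (n * \<rho>)\<^sup>2 / (8 * n) = n * \<mu>\<^sup>2 * \<rho>\<^sup>2 / 8"
    using assms(2) by (simp add: power2_eq_square)
  ultimately show ?thesis
    by (intro order_trans[OF Hoeffding_sg[OF assms(1) pos]]) simp
qed

text \<open>The product is positive as soon as both forms keep the signs of their means. Hoeffding's
  inequality is effective for both: each of \<open>U\<close> and \<open>W\<close> is at most
  \<open>2 * n\<close> in absolute value, so the other is at least
  \<open>n * \<rho>\<close>.\<close>

lemma Pr_product_nonpos:
  fixes A :: "'a set" and u v :: "'a \<Rightarrow> real" and n \<rho> :: real
  defines "U \<equiv> \<Sum>i\<in>A. u i" and "W \<equiv> \<Sum>i\<in>A. v i"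
  assumes "finite A" "\<eta> \<noteq> 1 / 2" "1 \<le> n"
    and uv: "0 \<le> (\<Sum>i\<in>A. u i * v i)"
    and u2: "(\<Sum>i\<in>A. (u i)\<^sup>2) \<le> 4 * n" and v2: "(\<Sum>i\<in>A. (v i)\<^sup>2) \<le> 4 * n"
    and U: "\<bar>U\<bar> \<le> 2 * n" and W: "\<bar>W\<bar> \<le> 2 * n" and "0 < \<rho>" and UW: "2 * n\<^sup>2 * \<rho> \<le> U * W"
  shows "Pr A (\<lambda>w. \<not> 0 < (\<Sum>i\<in>A. u i * sg (w i)) * (\<Sum>i\<in>A. v i * sg (w i)))
    \<le> exp (- (n * \<mu>\<^sup>2 * \<rho>\<^sup>2 / rate))"
proof (rule exp_tail_combine)
  show "0 \<le> n * \<mu>\<^sup>2 * \<rho>\<^sup>2" using assms(5) by simp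
  show "Pr A (\<lambda>w. \<not> 0 < (\<Sum>i\<in>A. u i * sg (w i)) * (\<Sum>i\<in>A. v i * sg (w i)))
      \<le> 1 - min 1 (n * \<mu>\<^sup>2 * \<rho>\<^sup>2) / 80^4"
    unfolding Pr_not[OF assms(3)]
    using Pr_product_pos_lower[OF assms(3-5) uv u2 v2 U[unfolded U_def] W[unfolded W_def] \<open>0 < \<rho>\<close> UW[unfolded U_def W_def]]
    by simp
  have n_pos: "0 < n" and \<rho>_nonneg: "0 \<le> \<rho>" using assms(5) \<open>0 < \<rho>\<close> by auto
  have "0 < 2 * n\<^sup>2 * \<rho>" using assms by simp
  then have UW_pos: "0 < U * W" using UW by linarith
  have bound: "n * \<rho> \<le> \<bar>x\<bar>" if "2 * n\<^sup>2 * \<rho> \<le> \<bar>x\<bar> * \<bar>y\<bar>" "\<bar>y\<bar> \<le> 2 * n" for x y :: real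
  proof -
    have "\<bar>x\<bar> * \<bar>y\<bar> \<le> \<bar>x\<bar> * (2 * n)" using that(2) by (intro mult_left_mono) auto
    then have "(n * \<rho>) * (2 * n) \<le> \<bar>x\<bar> * (2 * n)" using that(1) by (simp add: power2_eq_square algebra_simps)
    then show ?thesis using assms(5) by (simp add: mult_le_cancel_right)
  qed
  have UW': "2 * n\<^sup>2 * \<rho> \<le> \<bar>U\<bar> * \<bar>W\<bar>" "2 * n\<^sup>2 * \<rho> \<le> \<bar>W\<bar> * \<bar>U\<bar>"
    using UW UW_pos by (simp_all add: mult.commute flip: abs_mult)
  have Ub: "n * \<rho> \<le> \<bar>U\<bar>" and Wb: "n * \<rho> \<le> \<bar>W\<bar>"
    using bound[OF UW'(1) W] bound[OF UW'(2) U] .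
  \<comment> \<open>\<open>U\<close> and \<open>W\<close> have the same sign, so multiplication by
    \<open>\<sigma>\<close> makes both noisy means positive, whatever the sign of
    \<open>\<mu>\<close>.\<close>
  define \<sigma> where "\<sigma> = sgn (\<mu> * U)"
  have "\<mu> \<noteq> 0" "U \<noteq> 0" "W \<noteq> 0" using assms(4) UW_pos by auto
  then have \<sigma>: "\<bar>\<sigma>\<bar> = 1" "0 < \<sigma> * (\<mu> * U)" "\<sigma> * \<sigma> = 1" "\<sigma>\<^sup>2 = 1"
    unfolding \<sigma>_def by (auto simp: sgn_mult abs_mult sgn_if mult_less_0_iff zero_less_mult_iff power2_eq_square)
  have "0 < (\<sigma> * (\<mu> * U)) * (\<sigma> * (\<mu> * W))"
  proof -
    have "(\<sigma> * (\<mu> * U)) * (\<sigma> * (\<mu> * W)) = (\<sigma> * \<sigma>) * \<mu>\<^sup>2 * (U * W)" by algebra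
    also have "\<dots> = \<mu>\<^sup>2 * (U * W)" by (simp only: \<sigma>(3) mult_1)
    also have "0 < \<dots>" using \<open>\<mu> \<noteq> 0\<close> by (intro mult_pos_pos[OF _ UW_pos]) auto
    finally show ?thesis .
  qed
  then have \<sigma>W: "0 < \<sigma> * (\<mu> * W)" using \<sigma>(2) by (simp add: zero_less_mult_iff)
  have neg: "(\<Sum>i\<in>A. \<sigma> * a i * sg (w i)) = \<sigma> * (\<Sum>i\<in>A. a i * sg (w i))" for a and w :: "'a \<Rightarrow> bool"
    by (simp add: sum_distrib_left mult.assoc)
  have "Pr A (\<lambda>w. \<not> 0 < (\<Sum>i\<in>A. u i * sg (w i)) * (\<Sum>i\<in>A. v i * sg (w i)))
      \<le> Pr A (\<lambda>w. (\<Sum>i\<in>A. \<sigma> * u i * sg (w i)) \<le> 0 \<or> (\<Sum>i\<in>A. \<sigma> * v i * sg (w i)) \<le> 0)"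
  proof (intro Pr_mono assms(3))
    fix w :: "'a \<Rightarrow> bool"
    define x y where "x = (\<Sum>i\<in>A. u i * sg (w i))" and "y = (\<Sum>i\<in>A. v i * sg (w i))"
    have "0 < x * y" if "0 < \<sigma> * x" "0 < \<sigma> * y"
    proof -
      have "(\<sigma> * x) * (\<sigma> * y) = (\<sigma> * \<sigma>) * (x * y)" by simp
      also have "\<dots> = x * y" by (simp only: \<sigma>(3) mult_1)
      finally show ?thesis using mult_pos_pos[OF that] by (simp only:)
    qed
    then show "\<not> 0 < x * y \<Longrightarrow> (\<Sum>i\<in>A. \<sigma> * u i * sg (w i)) \<le> 0 \<or> (\<Sum>i\<in>A. \<sigma> * v i * sg (w i)) \<le> 0"
      unfolding neg x_def y_def by linarith
  qed
  also have "\<dots> \<le> Pr A (\<lambda>w. (\<Sum>i\<in>A. \<sigma> * u i * sg (w i)) \<le> 0) + Pr A (\<lambda>w. (\<Sum>i\<in>A. \<sigma> * v i * sg (w i)) \<le> 0)"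
    by (intro Pr_disj_le assms(3))
  also have "\<dots> \<le> exp (- (n * \<mu>\<^sup>2 * \<rho>\<^sup>2 / 8)) + exp (- (n * \<mu>\<^sup>2 * \<rho>\<^sup>2 / 8))"
  proof (intro add_mono Hoeffding_sg_margin assms(3) n_pos \<rho>_nonneg)
    have sq: "(\<Sum>i\<in>A. (\<sigma> * a i)\<^sup>2) = (\<Sum>i\<in>A. (a i)\<^sup>2)" for a
      by (simp add: power_mult_distrib \<sigma>(4))
    have lin: "(\<Sum>i\<in>A. \<sigma> * a i) = \<sigma> * (\<Sum>i\<in>A. a i)" for a
      by (rule sum_distrib_left[symmetric])
    show "(\<Sum>i\<in>A. (\<sigma> * u i)\<^sup>2) \<le> 4 * n" "(\<Sum>i\<in>A. (\<sigma> * v i)\<^sup>2) \<le> 4 * n"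
      unfolding sq by fact+
    show "0 < \<mu> * (\<Sum>i\<in>A. \<sigma> * u i)" "0 < \<mu> * (\<Sum>i\<in>A. \<sigma> * v i)"
      using \<sigma>(2) \<sigma>W unfolding lin U_def W_def by (simp_all only: mult.left_commute)
    show "n * \<rho> \<le> \<bar>\<Sum>i\<in>A. \<sigma> * u i\<bar>" "n * \<rho> \<le> \<bar>\<Sum>i\<in>A. \<sigma> * v i\<bar>"
      using Ub Wb unfolding lin abs_mult \<sigma>(1) mult_1 U_def W_def .
  qed
  finally show "Pr A (\<lambda>w. \<not> 0 < (\<Sum>i\<in>A. u i * sg (w i)) * (\<Sum>i\<in>A. v i * sg (w i)))
      \<le> 4 * exp (- (n * \<mu>\<^sup>2 * \<rho>\<^sup>2 / 8))"
    by (rule order_trans) simp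
qed

text \<open>The sets may overlap, so the sums are dependent. Being increasing for the same
  orientation \<open>s\<close>, the four events are positively correlated and their lower bounds
  1/80 multiply. The union bound supplies the tail.\<close>

lemma Pr_not_all_four_pos:
  fixes s :: "'a \<Rightarrow> real" and n \<rho> :: real
  assumes "finite A" "\<eta> < 1 / 2" "1 \<le> n" "card A \<le> n" "0 < \<rho>"
    and s: "\<And>i. i \<in> A \<Longrightarrow> s i = 1 \<or> s i = - 1"
    and sub: "B1 \<subseteq> A" "B2 \<subseteq> A" "B3 \<subseteq> A" "B4 \<subseteq> A"
    and sums: "n * \<rho> \<le> (\<Sum>i\<in>B1. s i)" "n * \<rho> \<le> (\<Sum>i\<in>B2. s i)"
      "n * \<rho> \<le> (\<Sum>i\<in>B3. s i)" "n * \<rho> \<le> (\<Sum>i\<in>B4. s i)"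
  shows "Pr A (\<lambda>w. \<not> ((0 < (\<Sum>i\<in>B1. s i * sg (w i)) \<and> 0 < (\<Sum>i\<in>B2. s i * sg (w i)))
      \<and> (0 < (\<Sum>i\<in>B3. s i * sg (w i)) \<and> 0 < (\<Sum>i\<in>B4. s i * sg (w i)))))
    \<le> exp (- (n * \<mu>\<^sup>2 * \<rho>\<^sup>2 / rate))" (is "?F \<le> _")
proof (rule exp_tail_combine)
  show "0 \<le> n * \<mu>\<^sup>2 * \<rho>\<^sup>2" using assms(3) by simp
  let ?P = "\<lambda>B w. 0 < (\<Sum>i\<in>B. s i * sg (w i))"
  have "0 < n * \<rho>" using assms(3,5) by simp
  have low: "1 / 80 \<le> Pr A (?P B)" if "B \<subseteq> A" "n * \<rho> \<le> (\<Sum>i\<in>B. s i)" for B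
    using that s assms(1,2) \<open>0 < n * \<rho>\<close> by (intro Pr_sign_sum_pos) auto
  have "1 / 80^4 = (1 / 80 * (1 / 80)) * (1 / 80 * (1 / 80 :: real))" by simp
  also have "\<dots> \<le> (Pr A (?P B1) * Pr A (?P B2)) * (Pr A (?P B3) * Pr A (?P B4))"
    using sub sums by (intro mult_mono low mult_nonneg_nonneg E_nonneg) auto
  also have "\<dots> \<le> Pr A (\<lambda>w. ?P B1 w \<and> ?P B2 w) * Pr A (\<lambda>w. ?P B3 w \<and> ?P B4 w)"
    by (intro mult_mono Harris_Pr[where s = s] assms(1) mono_wrt_sum_pos mult_nonneg_nonneg E_nonneg) auto
  also have "\<dots> \<le> Pr A (\<lambda>w. (?P B1 w \<and> ?P B2 w) \<and> (?P B3 w \<and> ?P B4 w))"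
    by (intro Harris_Pr[where s = s] assms(1) mono_wrt_conj mono_wrt_sum_pos)
  finally have "1 / 80^4 \<le> 1 - ?F"
    unfolding Pr_not[OF assms(1)] by simp
  then show "?F \<le> 1 - min 1 (n * \<mu>\<^sup>2 * \<rho>\<^sup>2) / 80^4" by simp
  have tail: "Pr A (\<lambda>w. \<not> ?P B w) \<le> exp (- (n * \<mu>\<^sup>2 * \<rho>\<^sup>2 / 8))"
    if "B \<subseteq> A" "n * \<rho> \<le> (\<Sum>i\<in>B. s i)" for B
  proof -
    \<comment> \<open>The weights are extended by 0, since Hoeffding's bound is stated for sums over
      all of \<open>A\<close>.\<close>
    define u where "u i = (if i \<in> B then s i else 0)" for i
    have eq: "(\<Sum>i\<in>A. u i * x i) = (\<Sum>i\<in>B. s i * x i)" for x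
      using that(1) assms(1) by (intro sum.mono_neutral_cong_right) (auto simp: u_def)
    have U: "(\<Sum>i\<in>A. u i) = (\<Sum>i\<in>B. s i)" using eq[of "\<lambda>_. 1"] by simp
    have "(\<Sum>i\<in>A. (u i)\<^sup>2) \<le> (\<Sum>i\<in>A. 1)"
      using s by (intro sum_mono) (force simp: u_def)
    then have u2: "(\<Sum>i\<in>A. (u i)\<^sup>2) \<le> n" using assms(4) by simp
    have pos: "0 < \<mu> * (\<Sum>i\<in>A. u i)"
      unfolding U using assms(2) that(2) \<open>0 < n * \<rho>\<close> by (intro mult_pos_pos) linarith+
    have "Pr A (\<lambda>w. (\<Sum>i\<in>A. u i * sg (w i)) \<le> 0) \<le> exp (- (n * \<mu>\<^sup>2 * \<rho>\<^sup>2 / 8))"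
      using assms(3,5) u2 that(2) by (intro Hoeffding_sg_margin assms(1) pos) (auto simp: U)
    then show ?thesis by (simp add: eq not_less)
  qed
  have "?F \<le> Pr A (\<lambda>w. (\<not> ?P B1 w \<or> \<not> ?P B2 w) \<or> (\<not> ?P B3 w \<or> \<not> ?P B4 w))"
    by (intro Pr_mono assms(1)) blast
  also have "\<dots> \<le> (Pr A (\<lambda>w. \<not> ?P B1 w) + Pr A (\<lambda>w. \<not> ?P B2 w)) + (Pr A (\<lambda>w. \<not> ?P B3 w) + Pr A (\<lambda>w. \<not> ?P B4 w))"
    by (intro order_trans[OF Pr_disj_le[OF assms(1)]] add_mono Pr_disj_le assms(1))
  also have "\<dots> \<le> 4 * exp (- (n * \<mu>\<^sup>2 * \<rho>\<^sup>2 / 8))"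
    using tail[OF sub(1) sums(1)] tail[OF sub(2) sums(2)] tail[OF sub(3) sums(3)] tail[OF sub(4) sums(4)]
    by linarith
  finally show "?F \<le> 4 * exp (- (n * \<mu>\<^sup>2 * \<rho>\<^sup>2 / 8))" .
qed

end

section \<open>The split criteria in terms of label sums\<close>

definition label_sum :: "(nat \<Rightarrow> int) \<Rightarrow> nat set \<Rightarrow> real" where
  "label_sum y A = (\<Sum>i\<in>A. real_of_int (y i))"

text \<open>The label sum is the excess of positive over negative labels. For empty \<open>A\<close>
  both sides are 0, by division by 0.\<close>

lemma class_fracs:
  assumes "finite A" "\<forall>i\<in>A. y i \<in> {1, - 1}"
  shows "pos_frac y A = (card A + label_sum y A) / (2 * card A)"
    and "neg_frac y A = (card A - label_sum y A) / (2 * card A)"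
proof -
  define P N where "P = {i \<in> A. y i = 1}" and "N = {i \<in> A. y i = - 1}"
  have A: "A = P \<union> N" and dis: "P \<inter> N = {}" and fin: "finite P" "finite N"
    using assms by (auto simp: P_def N_def)
  have "card A = card P + card N"
    unfolding A using fin dis by (rule card_Un_disjoint)
  moreover have "label_sum y A = (\<Sum>i\<in>P. real_of_int (y i)) + (\<Sum>i\<in>N. real_of_int (y i))"
    unfolding label_sum_def A using fin dis by (rule sum.union_disjoint)
  moreover have "(\<Sum>i\<in>P. real_of_int (y i)) = card P" by (simp add: P_def)
  moreover have "(\<Sum>i\<in>N. real_of_int (y i)) = - real (card N)" by (simp add: N_def)
  ultimately have "card A + label_sum y A = 2 * card P" "card A - label_sum y A = 2 * card N"
    by simp_all
  then show "pos_frac y A = (card A + label_sum y A) / (2 * card A)"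
    and "neg_frac y A = (card A - label_sum y A) / (2 * card A)"
    by (simp_all only: pos_frac_def neg_frac_def P_def[symmetric] N_def[symmetric]
        of_nat_mult of_nat_numeral)
qed

text \<open>For the mean label \<open>m\<close> of a nonempty node,
  \<open>2 * p * q = (1 - m\<^sup>2) / 2\<close>. The factor \<open>card A\<close> is the weight of
  the node in \<open>n\<close> times a gain.\<close>

lemma weighted_gini:
  assumes "finite A" "\<forall>i\<in>A. y i \<in> {1, - 1}"
  shows "card A * node_impurity gini y A = (card A - (label_sum y A)\<^sup>2 / card A) / 2"
proof (cases "card A = 0")
  case True then show ?thesis using assms(1) by (simp add: label_sum_def)
next
  case False
  then show ?thesis unfolding node_impurity_def gini_def class_fracs[OF assms]
    by (simp add: field_simps power2_eq_square)
qed

text \<open>Here \<open>min p q = (1 - \<bar>m\<bar>) / 2\<close> for the mean label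
  \<open>m\<close>.\<close>

lemma weighted_misclass:
  assumes "finite A" "\<forall>i\<in>A. y i \<in> {1, - 1}"
  shows "card A * node_impurity misclass y A = (card A - \<bar>label_sum y A\<bar>) / 2"
proof (cases "card A = 0")
  case True then show ?thesis using assms(1) by (simp add: label_sum_def)
next
  case False
  then have c: "0 < real (card A)" by simp
  have "real (card A) * min ((card A + label_sum y A) / (2 * card A)) ((card A - label_sum y A) / (2 * card A))
      = min ((card A + label_sum y A) / 2) ((card A - label_sum y A) / 2)"
    using c by (simp add: min_mult_distrib_left)
  also have "\<dots> = (card A - \<bar>label_sum y A\<bar>) / 2"
    by (simp add: min_def abs_if)
  finally show ?thesis unfolding node_impurity_def misclass_def class_fracs[OF assms] .
qed

lemma children:
  "finite (left_child n x f)" "finite (right_child n x f)"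
  "left_child n x f \<subseteq> {..<n}" "right_child n x f \<subseteq> {..<n}"
  "left_child n x f \<union> right_child n x f = {..<n}" "left_child n x f \<inter> right_child n x f = {}"
  by (auto simp: left_child_def right_child_def)

lemma sum_children: "sum g {..<n} = sum g (left_child n x f) + sum g (right_child n x f)" for g :: "nat \<Rightarrow> real"
  using sum.union_disjoint[OF children(1,2,6)] by (simp add: children(5))

lemma card_children: "n = card (left_child n x f) + card (right_child n x f)"
  using card_Un_disjoint[OF children(1,2,6)] by (simp add: children(5))

lemma right_frac:
  assumes "0 < n"
  shows "1 - left_frac n x f = card (right_child n x f) / n"
proof -
  have "real n = card (left_child n x f) + card (right_child n x f)"
    using card_children by (metis of_nat_add)
  then show ?thesis using assms by (simp add: left_frac_def field_simps)
qed

lemma gain_scaled: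
  assumes "0 < n"
  shows "n * gain G n x y f = card {..<n} * node_impurity G y {..<n}
    - card (left_child n x f) * node_impurity G y (left_child n x f)
    - card (right_child n x f) * node_impurity G y (right_child n x f)"
  unfolding gain_def right_frac[OF assms] using assms by (simp add: left_frac_def field_simps)

text \<open>The sum of \<open>split_weight n x f i * y i\<close> is \<open>n * sqrt (a * (1 - a))\<close> times the difference of
  the mean labels of the children. A split with an empty child gets weight 0, in agreement with the
  value 0 of its criteria.\<close>
definition split_weight :: "nat \<Rightarrow> (nat \<Rightarrow> real list) \<Rightarrow> (real list \<Rightarrow> bool) \<Rightarrow> nat \<Rightarrow> real" where
  "split_weight n x f i =
     (let l = real (card (left_child n x f)); r = real (card (right_child n x f))
      in if l = 0 \<or> r = 0 then 0 else if f (x i) then sqrt (r / l) else - sqrt (l / r))"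

lemma split_weight_children:
  assumes "card (left_child n x f) \<noteq> 0" "card (right_child n x f) \<noteq> 0"
  shows "i \<in> left_child n x f \<Longrightarrow> split_weight n x f i = sqrt (card (right_child n x f) / card (left_child n x f))"
    and "i \<in> right_child n x f \<Longrightarrow> split_weight n x f i = - sqrt (card (left_child n x f) / card (right_child n x f))"
proof -
  have "i \<in> left_child n x f \<Longrightarrow> f (x i)" "i \<in> right_child n x f \<Longrightarrow> \<not> f (x i)"
    by (auto simp: left_child_def right_child_def)
  then show "i \<in> left_child n x f \<Longrightarrow> split_weight n x f i = sqrt (card (right_child n x f) / card (left_child n x f))"
    and "i \<in> right_child n x f \<Longrightarrow> split_weight n x f i = - sqrt (card (left_child n x f) / card (right_child n x f))"
    using assms by (simp_all add: split_weight_def Let_def)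
qed

lemma sum_split_weight:
  fixes z :: "nat \<Rightarrow> real" and n :: nat and x and f
  defines "l \<equiv> real (card (left_child n x f))" and "r \<equiv> real (card (right_child n x f))"
  assumes "l \<noteq> 0" "r \<noteq> 0"
  shows "(\<Sum>i<n. split_weight n x f i * z i)
    = sqrt (r / l) * sum z (left_child n x f) - sqrt (l / r) * sum z (right_child n x f)"
proof -
  have "(\<Sum>i\<in>left_child n x f. split_weight n x f i * z i) = (\<Sum>i\<in>left_child n x f. sqrt (r / l) * z i)"
    using assms(3,4) by (intro sum.cong refl) (simp add: split_weight_children l_def r_def)
  moreover have "(\<Sum>i\<in>right_child n x f. split_weight n x f i * z i) = (\<Sum>i\<in>right_child n x f. - sqrt (l / r) * z i)"
    using assms(3,4) by (intro sum.cong refl) (simp add: split_weight_children l_def r_def)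
  ultimately show ?thesis
    unfolding sum_children[of _ n x f] by (simp add: sum_distrib_left sum_negf)
qed

lemma split_weight_trivial:
  "card (left_child n x f) = 0 \<or> card (right_child n x f) = 0 \<Longrightarrow> split_weight n x f i = 0"
  by (auto simp: split_weight_def Let_def)

text \<open>There are \<open>l\<close> weights of square \<open>r / l\<close> and \<open>r\<close>
  weights of square \<open>l / r\<close>. As all nontrivial splits have the same norm, the sum and
  the difference of two such weight vectors are orthogonal.\<close>

lemma sum_split_weight_square:
  "(\<Sum>i<n. (split_weight n x f i)\<^sup>2) = (if card (left_child n x f) = 0 \<or> card (right_child n x f) = 0 then 0 else n)"
proof (cases "card (left_child n x f) = 0 \<or> card (right_child n x f) = 0")
  case True then show ?thesis by (simp add: split_weight_trivial)
next
  case False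
  define l r where "l = real (card (left_child n x f))" and "r = real (card (right_child n x f))"
  have lr: "0 < l" "0 < r" using False by (auto simp: l_def r_def)
  have "(\<Sum>i\<in>left_child n x f. (split_weight n x f i)\<^sup>2) = (\<Sum>i\<in>left_child n x f. r / l)"
    using lr by (intro sum.cong refl) (simp add: split_weight_children l_def r_def)
  moreover have "(\<Sum>i\<in>right_child n x f. (split_weight n x f i)\<^sup>2) = (\<Sum>i\<in>right_child n x f. l / r)"
    using lr by (intro sum.cong refl) (simp add: split_weight_children l_def r_def)
  moreover have "real n = l + r" unfolding l_def r_def using card_children by (metis of_nat_add)
  ultimately show ?thesis
    unfolding sum_children[of _ n x f] using False lr by (simp add: l_def[symmetric] r_def[symmetric])
qed

section \<open>The criteria as functions of the labels\<close>

definition split_stat :: "nat \<Rightarrow> (nat \<Rightarrow> real list) \<Rightarrow> (nat \<Rightarrow> int) \<Rightarrow> (real list \<Rightarrow> bool) \<Rightarrow> real" where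
  "split_stat n x y f = (\<Sum>i<n. split_weight n x f i * real_of_int (y i))"

lemma split_stat_square:
  fixes n :: nat and x and y and f
  defines "l \<equiv> real (card (left_child n x f))" and "r \<equiv> real (card (right_child n x f))"
  assumes "l \<noteq> 0" "r \<noteq> 0"
  shows "(split_stat n x y f)\<^sup>2 = (r * label_sum y (left_child n x f) - l * label_sum y (right_child n x f))\<^sup>2 / (l * r)"
proof -
  define S T where "S = label_sum y (left_child n x f)" and "T = label_sum y (right_child n x f)"
  have lr: "0 < l" "0 < r" using assms by (auto simp: l_def r_def)
  have *: "sqrt (r / l) = r / sqrt (l * r)" "sqrt (l / r) = l / sqrt (l * r)"
    using lr by (simp_all add: real_sqrt_divide real_sqrt_mult field_simps)
  have "split_stat n x y f = (r * S - l * T) / sqrt (l * r)"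
    unfolding split_stat_def using sum_split_weight[of n x f "\<lambda>i. real_of_int (y i)"] assms(3,4)
    by (simp add: l_def[symmetric] r_def[symmetric] * S_def T_def label_sum_def diff_divide_distrib)
  then show ?thesis using lr by (simp add: power_divide S_def T_def)
qed

text \<open>The Gini impurity is half the variance of the labels, so the gain is half of the
  variance between the children.\<close>

lemma gain_gini_eq:
  assumes "0 < n" and y: "\<forall>i<n. y i \<in> {1, - 1}"
  shows "gain gini n x y f = (split_stat n x y f)\<^sup>2 / (2 * (real n)\<^sup>2)"
proof -
  define l r S T where "l = real (card (left_child n x f))" and "r = real (card (right_child n x f))"
    and "S = label_sum y (left_child n x f)" and "T = label_sum y (right_child n x f)"
  have n: "real n = l + r" unfolding l_def r_def using card_children by (metis of_nat_add)
  have sum: "label_sum y {..<n} = S + T"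
    unfolding label_sum_def S_def T_def by (rule sum_children)
  have yl: "\<forall>i\<in>left_child n x f. y i \<in> {1, - 1}" and yr: "\<forall>i\<in>right_child n x f. y i \<in> {1, - 1}"
    using y by (auto simp: left_child_def right_child_def)
  have yn: "\<forall>i\<in>{..<n}. y i \<in> {1, - 1}" using y by simp
  have g: "real n * gain gini n x y f = (real n - (S + T)\<^sup>2 / real n) / 2 - (l - S\<^sup>2 / l) / 2 - (r - T\<^sup>2 / r) / 2"
    unfolding gain_scaled[OF assms(1)] weighted_gini[OF children(1) yl] weighted_gini[OF children(2) yr]
      weighted_gini[OF finite_lessThan yn] sum
    by (simp add: l_def r_def S_def T_def)
  show ?thesis
  proof (cases "l = 0 \<or> r = 0")
    case True
    have "l = 0 \<Longrightarrow> S = 0" "r = 0 \<Longrightarrow> T = 0"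
      using children(1,2)[of n x f] by (auto simp: l_def r_def S_def T_def label_sum_def)
    then have "(l + r - (S + T)\<^sup>2 / (l + r)) / 2 - (l - S\<^sup>2 / l) / 2 - (r - T\<^sup>2 / r) / 2 = 0"
      using True by auto
    then have "real n * gain gini n x y f = 0"
      unfolding g unfolding n .
    moreover have "split_stat n x y f = 0"
      using True by (auto simp: split_stat_def split_weight_trivial l_def r_def)
    ultimately show ?thesis using assms(1) by simp
  next
    case False
    then have lr: "0 < l" "0 < r" by (auto simp: l_def r_def)
    have "real n * gain gini n x y f = (r * S - l * T)\<^sup>2 / (l * r) / (2 * real n)"
    proof -
      \<comment> \<open>The sum of squares between two groups of sizes \<open>l\<close> and
        \<open>r\<close>.\<close>
      have "S\<^sup>2 / l + T\<^sup>2 / r - (S + T)\<^sup>2 / (l + r) = (r * S - l * T)\<^sup>2 / (l * r) / (l + r)"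
      proof -
        have "l + r \<noteq> 0" using lr by simp
        then show ?thesis using lr by (simp add: divide_simps) algebra
      qed
      moreover have "(l + r - a) / 2 - (l - b) / 2 - (r - c) / 2 = (b + c - a) / 2" for a b c :: real
        by (simp add: field_simps)
      ultimately show ?thesis unfolding g unfolding n by (simp only: divide_divide_eq_left mult_ac)
    qed
    also have "(r * S - l * T)\<^sup>2 / (l * r) = (split_stat n x y f)\<^sup>2"
      using split_stat_square[of n x f y] False
      by (simp add: l_def[symmetric] r_def[symmetric] S_def[symmetric] T_def[symmetric])
    finally show ?thesis using assms(1) by (simp add: field_simps power2_eq_square)
  qed
qed

text \<open>In nonempty children positive and negative fractions add up to 1, so both absolute
  values agree and the criterion is half of the Gini gain.\<close>

lemma twoing_eq:
  assumes "0 < n" and y: "\<forall>i<n. y i \<in> {1, - 1}"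
  shows "twoing n x y f = (split_stat n x y f)\<^sup>2 / (4 * (real n)\<^sup>2)"
proof -
  define l r S T where "l = real (card (left_child n x f))" and "r = real (card (right_child n x f))"
    and "S = label_sum y (left_child n x f)" and "T = label_sum y (right_child n x f)"
  have yl: "\<forall>i\<in>left_child n x f. y i \<in> {1, - 1}" and yr: "\<forall>i\<in>right_child n x f. y i \<in> {1, - 1}"
    using y by (auto simp: left_child_def right_child_def)
  show ?thesis
  proof (cases "l = 0 \<or> r = 0")
    case True
    then have "left_frac n x f * (1 - left_frac n x f) = 0"
      using right_frac[OF assms(1), of x f] by (auto simp: left_frac_def l_def r_def)
    moreover have "split_stat n x y f = 0"
      using True by (auto simp: split_stat_def split_weight_trivial l_def r_def)
    ultimately show ?thesis by (simp add: twoing_def)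
  next
    case False
    then have lr: "0 < l" "0 < r" by (auto simp: l_def r_def)
    have p: "(l + S) / (2 * l) - (r + T) / (2 * r) = (r * S - l * T) / (2 * (l * r))"
      "(l - S) / (2 * l) - (r - T) / (2 * r) = - ((r * S - l * T) / (2 * (l * r)))"
      using lr by (simp_all add: field_simps)
    have "twoing n x y f = (l / real n) * (r / real n) / 4 * (2 * \<bar>(r * S - l * T) / (2 * (l * r))\<bar>)\<^sup>2"
      unfolding twoing_def right_frac[OF assms(1)] class_fracs[OF children(1) yl] class_fracs[OF children(2) yr]
        l_def[symmetric] r_def[symmetric] S_def[symmetric] T_def[symmetric] p
      by (simp add: left_frac_def l_def[symmetric] r_def[symmetric] p)
    also have "\<dots> = (r * S - l * T)\<^sup>2 / (l * r) / (4 * (real n)\<^sup>2)"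
      using lr assms(1) by (simp add: power_mult_distrib power_divide field_simps power2_eq_square)
    finally show ?thesis
      using split_stat_square[of n x f y] False
      by (simp add: l_def[symmetric] r_def[symmetric] S_def[symmetric] T_def[symmetric])
  qed
qed

lemma gain_misclass_eq:
  assumes "0 < n" and y: "\<forall>i<n. y i \<in> {1, - 1}"
  shows "gain misclass n x y f = (\<bar>label_sum y (left_child n x f)\<bar> + \<bar>label_sum y (right_child n x f)\<bar>
    - \<bar>label_sum y {..<n}\<bar>) / (2 * n)"
proof -
  have yl: "\<forall>i\<in>left_child n x f. y i \<in> {1, - 1}" and yr: "\<forall>i\<in>right_child n x f. y i \<in> {1, - 1}"
    using y by (auto simp: left_child_def right_child_def)
  have yn: "\<forall>i\<in>{..<n}. y i \<in> {1, - 1}" using y by simp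
  have n: "real n = real (card (left_child n x f)) + real (card (right_child n x f))"
    using card_children by (metis of_nat_add)
  have "n * gain misclass n x y f = (\<bar>label_sum y (left_child n x f)\<bar> + \<bar>label_sum y (right_child n x f)\<bar>
    - \<bar>label_sum y {..<n}\<bar>) / 2"
    unfolding gain_scaled[OF assms(1)] weighted_misclass[OF children(1) yl] weighted_misclass[OF children(2) yr]
      weighted_misclass[OF finite_lessThan yn]
    using n by (simp add: field_simps)
  then show ?thesis using assms(1) by (simp add: field_simps)
qed

section \<open>Failure probabilities of the criteria\<close>

definition flip_labels :: "(nat \<Rightarrow> int) \<Rightarrow> (nat \<Rightarrow> bool) \<Rightarrow> nat \<Rightarrow> int" where
  "flip_labels y w i = (if w i then - y i else y i)"

lemma real_flip_labels: "real_of_int (flip_labels y w i) = real_of_int (y i) * sg (w i)"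
  by (simp add: flip_labels_def)

lemma flip_labels_range: "y i \<in> {1, - 1} \<Longrightarrow> flip_labels y w i \<in> {1, - 1}"
  by (auto simp: flip_labels_def)

text \<open>Cauchy-Schwarz: the weights and the labels both have squared norm at most
  \<open>n\<close>.\<close>

lemma split_stat_bound:
  assumes "\<forall>i<n. y i \<in> {1, - 1}"
  shows "\<bar>split_stat n x y f\<bar> \<le> n"
proof -
  have "(split_stat n x y f)\<^sup>2 \<le> (\<Sum>i<n. (split_weight n x f i)\<^sup>2) * (\<Sum>i<n. (real_of_int (y i))\<^sup>2)"
    unfolding split_stat_def by (rule Cauchy_Schwarz_ineq_sum)
  also have "(\<Sum>i<n. (real_of_int (y i))\<^sup>2) = (\<Sum>i<n. 1)"
    using assms by (intro sum.cong) fastforce+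
  also have "(\<Sum>i<n. (split_weight n x f i)\<^sup>2) * (\<Sum>i<n. 1) \<le> real n * real n"
    by (simp add: sum_split_weight_square)
  finally have "(split_stat n x y f)\<^sup>2 \<le> (real n)\<^sup>2" by (simp add: power2_eq_square)
  then show ?thesis using abs_le_square_iff[of "split_stat n x y f" "real n"] by simp
qed

section \<open>Comparison of two misclassification gains\<close>

lemma abs_add_abs: "\<bar>a\<bar> + \<bar>b\<bar> = max (\<bar>a + b\<bar>) (\<bar>a - b\<bar>)" for a b :: real
  by (simp add: max_def abs_if)

text \<open>Up to sign, \<open>X L - X R\<close> is the total label sum, and
  \<open>X L + X R\<close> and \<open>X same - X diff\<close> are the differences of the child sums
  for \<open>f\<close> and for \<open>g\<close>. By \<open>abs_add_abs\<close> the total is thus a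
  common term of both maxima.\<close>

lemma misclass_sums:
  fixes n x f g \<tau> and z :: "nat \<Rightarrow> int"
  assumes \<tau>: "\<tau> = 1 \<or> \<tau> = - 1"
  defines "c \<equiv> \<lambda>i. \<tau> * (if f (x i) then 1 else - 1 :: real)"
  defines "X \<equiv> \<lambda>B. \<Sum>i\<in>B. c i * real_of_int (z i)"
  defines "same \<equiv> {i. i < n \<and> f (x i) = g (x i)}" and "diff \<equiv> {i. i < n \<and> f (x i) \<noteq> g (x i)}"
  defines "L \<equiv> left_child n x f" and "R \<equiv> right_child n x f"
  shows "label_sum z L = \<tau> * X L" "label_sum z R = - (\<tau> * X R)"
    "X L + X R = X same + X diff"
    "\<bar>label_sum z L\<bar> + \<bar>label_sum z R\<bar> = max (\<bar>X L - X R\<bar>) (\<bar>X L + X R\<bar>)"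
    "\<bar>label_sum z (left_child n x g)\<bar> + \<bar>label_sum z (right_child n x g)\<bar> = max (\<bar>X L - X R\<bar>) (\<bar>X same - X diff\<bar>)"
proof -
  have \<tau>\<tau>: "\<tau> * \<tau> = 1" using \<tau> by auto
  show L: "label_sum z L = \<tau> * X L"
    unfolding label_sum_def X_def sum_distrib_left using \<tau>
    by (intro sum.cong) (auto simp: c_def L_def left_child_def)
  show R: "label_sum z R = - (\<tau> * X R)"
    unfolding label_sum_def X_def sum_distrib_left sum_negf[symmetric] using \<tau>
    by (intro sum.cong) (auto simp: c_def R_def right_child_def)
  have part: "{..<n} = same \<union> diff" "same \<inter> diff = {}" "finite same" "finite diff"
    by (auto simp: same_def diff_def)
  have X_all: "X {..<n} = X same + X diff"
    unfolding part(1) X_def using part(2-4) by (intro sum.union_disjoint)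
  have "X {..<n} = X L + X R"
    unfolding X_def L_def R_def by (rule sum_children)
  with X_all show eq: "X L + X R = X same + X diff" by simp
  have absmul: "\<bar>\<tau> * a\<bar> = \<bar>a\<bar>" for a using \<tau> by auto
  show "\<bar>label_sum z L\<bar> + \<bar>label_sum z R\<bar> = max (\<bar>X L - X R\<bar>) (\<bar>X L + X R\<bar>)"
    unfolding L R abs_minus_cancel absmul by (simp add: abs_add_abs max.commute)
  have tot: "label_sum z (left_child n x g) + label_sum z (right_child n x g) = label_sum z L + label_sum z R"
    unfolding label_sum_def L_def R_def using sum_children by metis
  have "label_sum z (left_child n x g) - label_sum z (right_child n x g) = \<tau> * (X same - X diff)"
  proof -
    define e where "e i = (if g (x i) then 1 else - 1 :: real)" for i
    have "label_sum z (left_child n x g) = (\<Sum>i\<in>left_child n x g. e i * z i)"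
      unfolding label_sum_def by (intro sum.cong) (auto simp: e_def left_child_def)
    moreover have "- label_sum z (right_child n x g) = (\<Sum>i\<in>right_child n x g. e i * z i)"
      unfolding label_sum_def sum_negf[symmetric] by (intro sum.cong) (auto simp: e_def right_child_def)
    moreover have "(\<Sum>i<n. e i * z i) = (\<Sum>i\<in>same. e i * z i) + (\<Sum>i\<in>diff. e i * z i)"
      unfolding part(1) using part(2-4) by (intro sum.union_disjoint)
    moreover have "(\<Sum>i\<in>same. e i * z i) = \<tau> * X same"
      unfolding X_def sum_distrib_left using \<tau> by (intro sum.cong) (auto simp: c_def e_def same_def)
    moreover have "(\<Sum>i\<in>diff. e i * z i) = - (\<tau> * X diff)"
      unfolding X_def sum_distrib_left sum_negf[symmetric] using \<tau>
      by (intro sum.cong) (auto simp: c_def e_def diff_def)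
    ultimately show ?thesis
      using sum_children[of "\<lambda>i. e i * z i" n x g] by (simp add: right_diff_distrib)
  qed
  moreover have "label_sum z L + label_sum z R = \<tau> * (X L - X R)"
    unfolding L R by (simp add: right_diff_distrib)
  ultimately show "\<bar>label_sum z (left_child n x g)\<bar> + \<bar>label_sum z (right_child n x g)\<bar> = max (\<bar>X L - X R\<bar>) (\<bar>X same - X diff\<bar>)"
    unfolding abs_add_abs tot by (simp only: absmul)
qed

text \<open>The term \<open>\<bar>a - b\<bar>\<close> occurs in both maxima, so a positive gap can
  only come from \<open>\<bar>a + b\<bar>\<close>, which exceeds \<open>\<bar>a - b\<bar>\<close>
  and \<open>\<bar>c - d\<bar>\<close> by at least \<open>2 * m\<close>. Then \<open>a\<close>,
  \<open>b\<close> have one sign, as do \<open>c\<close>, \<open>d\<close>, and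
  \<open>0 \<le> a\<close> makes it positive.\<close>

lemma max_abs_margin:
  fixes a b c d m :: real
  assumes "0 \<le> a" "0 < m" "a + b = c + d" "2 * m = max (\<bar>a - b\<bar>) (\<bar>a + b\<bar>) - max (\<bar>a - b\<bar>) (\<bar>c - d\<bar>)"
  shows "m \<le> a" "m \<le> b" "m \<le> c" "m \<le> d"
proof -
  define N where "N = max (\<bar>a - b\<bar>) (\<bar>c - d\<bar>)"
  have N: "\<bar>a - b\<bar> \<le> N" "\<bar>c - d\<bar> \<le> N" by (auto simp: N_def)
  have "2 * m = max (\<bar>a - b\<bar>) (\<bar>a + b\<bar>) - N" using assms(4) by (simp add: N_def)
  moreover have "max (\<bar>a - b\<bar>) (\<bar>a + b\<bar>) = \<bar>a - b\<bar> \<or> max (\<bar>a - b\<bar>) (\<bar>a + b\<bar>) = \<bar>a + b\<bar>" by (auto simp: max_def)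
  ultimately have M: "2 * m = \<bar>a + b\<bar> - N" using N(1) assms(2) by linarith
  then have "0 < b" using N(1) assms(1,2) by linarith
  then show "m \<le> a" "m \<le> b" "m \<le> c" "m \<le> d" using M N assms(1,3) by linarith+
qed

text \<open>A converse of \<open>max_abs_margin\<close> for the noisy sums, about which only
  positivity is known.\<close>

lemma max_abs_less:
  fixes a b c d :: real
  assumes "0 < a" "0 < b" "0 < c" "0 < d" "a + b = c + d"
  shows "max (\<bar>a - b\<bar>) (\<bar>c - d\<bar>) < max (\<bar>a - b\<bar>) (\<bar>a + b\<bar>)"
proof -
  have "\<bar>a - b\<bar> < \<bar>a + b\<bar>" "\<bar>c - d\<bar> < \<bar>a + b\<bar>" using assms by linarith+
  then show ?thesis by (simp add: less_max_iff_disj)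
qed

lemma exp_rate_le:
  fixes n \<rho> m \<delta> :: real
  assumes "\<rho> \<noteq> 0" "m \<noteq> 0" "0 < \<delta>" and n: "rate * (1 / (\<rho>\<^sup>2 * m\<^sup>2) * ln (1 / \<delta>)) \<le> n"
  shows "exp (- (n * m\<^sup>2 * \<rho>\<^sup>2 / rate)) \<le> \<delta>"
proof -
  have pos: "0 < \<rho>\<^sup>2 * m\<^sup>2" using assms(1,2) by simp
  have "ln (1 / \<delta>) = rate * (1 / (\<rho>\<^sup>2 * m\<^sup>2) * ln (1 / \<delta>)) * (\<rho>\<^sup>2 * m\<^sup>2) / rate"
    using assms(1,2) rate_pos by (simp add: field_simps)
  also have "\<dots> \<le> n * (\<rho>\<^sup>2 * m\<^sup>2) / rate"
    using n pos rate_pos by (intro divide_right_mono mult_right_mono) auto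
  finally have "- (n * m\<^sup>2 * \<rho>\<^sup>2 / rate) \<le> ln \<delta>"
    using assms(3) by (simp add: ln_div ac_simps)
  then have "exp (- (n * m\<^sup>2 * \<rho>\<^sup>2 / rate)) \<le> exp (ln \<delta>)" by simp
  then show ?thesis using assms(3) by simp
qed

section \<open>Failure bounds for noisy labels\<close>

context flip_rate
begin

lemma prob_noisy_labels:
  "measure_pmf.prob (noisy_labels n \<eta> y) {y'. P y'} = Pr {..<n} (\<lambda>w. P (flip_labels y w))"
proof -
  have "noisy_labels n \<eta> y = map_pmf (flip_labels y) (flips {..<n})"
    unfolding noisy_labels_def flips_def by (intro map_pmf_cong) (auto simp: flip_labels_def)
  then show ?thesis by (simp add: vimage_def prob_eq_E)
qed

text \<open>The Gini gain has \<open>k = 1 / 2\<close> and the twoing criterion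
  \<open>k = 1 / 4\<close>. A difference of squared statistics is the product of their difference
  and their sum, with weights \<open>u\<close> and \<open>v\<close> that include the true
  labels.\<close>

lemma square_criterion_failure:
  fixes C :: "(nat \<Rightarrow> int) \<Rightarrow> (real list \<Rightarrow> bool) \<Rightarrow> real"
  assumes "0 < n" "\<eta> \<noteq> 1 / 2" and y: "\<forall>i<n. y i \<in> {1, - 1}"
    and k: "0 < k" "k \<le> 1 / 2"
    and C: "\<And>y f. (\<forall>i<n. y i \<in> {1, - 1}) \<Longrightarrow> C y f = k * (split_stat n x y f)\<^sup>2 / (real n)\<^sup>2"
    and \<rho>: "\<rho> = C y f1 - C y f2" "0 < \<rho>"
  shows "Pr {..<n} (\<lambda>w. \<not> C (flip_labels y w) f2 < C (flip_labels y w) f1) \<le> exp (- (n * \<mu>\<^sup>2 * \<rho>\<^sup>2 / rate))"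
proof -
  define w1 w2 where "w1 = split_weight n x f1" and "w2 = split_weight n x f2"
  define u v where "u i = (w1 i - w2 i) * real_of_int (y i)" and "v i = (w1 i + w2 i) * real_of_int (y i)" for i
  have y2: "(real_of_int (y i))\<^sup>2 = 1" if "i < n" for i using y that by auto
  have stat: "(\<Sum>i<n. u i * sg (w i)) = split_stat n x (flip_labels y w) f1 - split_stat n x (flip_labels y w) f2"
    "(\<Sum>i<n. v i * sg (w i)) = split_stat n x (flip_labels y w) f1 + split_stat n x (flip_labels y w) f2" for w
    by (simp_all add: split_stat_def u_def v_def w1_def w2_def real_flip_labels algebra_simps
        sum.distrib sum_subtractf)
  have stat0: "(\<Sum>i<n. u i) = split_stat n x y f1 - split_stat n x y f2"
    "(\<Sum>i<n. v i) = split_stat n x y f1 + split_stat n x y f2"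
    by (simp_all add: split_stat_def u_def v_def w1_def w2_def algebra_simps sum.distrib sum_subtractf)
  have flip_y: "\<forall>i<n. flip_labels y w i \<in> {1, - 1}" for w
    using y by (intro allI impI flip_labels_range) blast
  have event: "(C (flip_labels y w) f2 < C (flip_labels y w) f1)
      \<longleftrightarrow> 0 < (\<Sum>i<n. u i * sg (w i)) * (\<Sum>i<n. v i * sg (w i))" for w
  proof -
    have "(\<Sum>i<n. u i * sg (w i)) * (\<Sum>i<n. v i * sg (w i))
        = (split_stat n x (flip_labels y w) f1)\<^sup>2 - (split_stat n x (flip_labels y w) f2)\<^sup>2"
      unfolding stat by algebra
    then show ?thesis
      unfolding C[OF flip_y[of w]] using assms(1) k(1)
      by (simp add: divide_less_cancel)
  qed
  have UW: "2 * (real n)\<^sup>2 * \<rho> \<le> (\<Sum>i<n. u i) * (\<Sum>i<n. v i)"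
  proof -
    have "(\<Sum>i<n. u i) * (\<Sum>i<n. v i) = (split_stat n x y f1)\<^sup>2 - (split_stat n x y f2)\<^sup>2"
      unfolding stat0 by algebra
    also have "\<dots> = (real n)\<^sup>2 * \<rho> / k"
      unfolding \<rho>(1) C[OF y] using assms(1) k(1) by (simp add: field_simps)
    also have "\<dots> \<ge> (real n)\<^sup>2 * \<rho> / (1 / 2)"
      using k \<rho>(2) by (intro divide_left_mono) auto
    finally show ?thesis by simp
  qed
  have uv: "0 \<le> (\<Sum>i<n. u i * v i)"
  proof -
    have "u i * v i = (w1 i)\<^sup>2 - (w2 i)\<^sup>2" if "i < n" for i
      using y2[OF that] unfolding u_def v_def by algebra
    then have "(\<Sum>i<n. u i * v i) = (\<Sum>i<n. (w1 i)\<^sup>2) - (\<Sum>i<n. (w2 i)\<^sup>2)"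
      by (simp add: sum_subtractf)
    \<comment> \<open>The criterion of \<open>f1\<close> exceeds a nonnegative value, so
      \<open>f1\<close> has two nonempty children. Its weights then have squared norm
      \<open>n\<close>, the largest possible.\<close>
    moreover have "card (left_child n x f1) \<noteq> 0 \<and> card (right_child n x f1) \<noteq> 0"
    proof (rule ccontr)
      assume "\<not> ?thesis"
      then have "split_stat n x y f1 = 0" by (auto simp: split_stat_def split_weight_trivial)
      then have "\<rho> \<le> 0" unfolding \<rho>(1) C[OF y] using k by simp
      then show False using \<rho>(2) by simp
    qed
    ultimately show ?thesis unfolding w1_def w2_def by (simp add: sum_split_weight_square)
  qed
  have sq: "(\<Sum>i<n. (w1 i)\<^sup>2) \<le> n" "(\<Sum>i<n. (w2 i)\<^sup>2) \<le> n"
    by (simp_all add: w1_def w2_def sum_split_weight_square)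
  have "(\<Sum>i<n. (u i)\<^sup>2) \<le> (\<Sum>i<n. 2 * (w1 i)\<^sup>2 + 2 * (w2 i)\<^sup>2)"
    "(\<Sum>i<n. (v i)\<^sup>2) \<le> (\<Sum>i<n. 2 * (w1 i)\<^sup>2 + 2 * (w2 i)\<^sup>2)"
  proof -
    have "(a - b)\<^sup>2 \<le> 2 * a\<^sup>2 + 2 * b\<^sup>2" "(a + b)\<^sup>2 \<le> 2 * a\<^sup>2 + 2 * b\<^sup>2" for a b :: real
      using zero_le_power2[of "a + b"] zero_le_power2[of "a - b"]
      by (simp_all add: power2_eq_square algebra_simps)
    then show "(\<Sum>i<n. (u i)\<^sup>2) \<le> (\<Sum>i<n. 2 * (w1 i)\<^sup>2 + 2 * (w2 i)\<^sup>2)"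
      "(\<Sum>i<n. (v i)\<^sup>2) \<le> (\<Sum>i<n. 2 * (w1 i)\<^sup>2 + 2 * (w2 i)\<^sup>2)"
      by (auto intro!: sum_mono simp: u_def v_def power_mult_distrib y2)
  qed
  then have u2: "(\<Sum>i<n. (u i)\<^sup>2) \<le> 4 * n" and v2: "(\<Sum>i<n. (v i)\<^sup>2) \<le> 4 * n"
    using sq by (simp_all add: sum.distrib flip: sum_distrib_left)
  have "\<bar>\<Sum>i<n. u i\<bar> \<le> 2 * n" "\<bar>\<Sum>i<n. v i\<bar> \<le> 2 * n"
    unfolding stat0 using split_stat_bound[OF y, of x f1] split_stat_bound[OF y, of x f2] by linarith+
  then show ?thesis
    unfolding event using assms(1,2) uv u2 v2 UW \<rho>(2) by (intro Pr_product_nonpos) auto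
qed

lemma misclass_failure_less_half:
  assumes "0 < n" "\<eta> < 1 / 2" and y: "\<forall>i<n. y i \<in> {1, - 1}"
    and \<rho>: "\<rho> = gain misclass n x y f1 - gain misclass n x y f2" "0 < \<rho>"
  shows "Pr {..<n} (\<lambda>w. \<not> gain misclass n x (flip_labels y w) f2 < gain misclass n x (flip_labels y w) f1)
    \<le> exp (- (n * \<mu>\<^sup>2 * \<rho>\<^sup>2 / rate))"
proof -
  define L R where "L = left_child n x f1" and "R = right_child n x f1"
  define same diff where "same = {i. i < n \<and> f1 (x i) = f2 (x i)}" and "diff = {i. i < n \<and> f1 (x i) \<noteq> f2 (x i)}"
  \<comment> \<open>orients the labels so that the sum over the left child of \<open>f1\<close> is nonnegative\<close>
  define \<tau> :: real where "\<tau> = (if 0 \<le> label_sum y L then 1 else - 1)"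
  define c where "c = (\<lambda>i. \<tau> * (if f1 (x i) then 1 else - 1 :: real))"
  define X where "X z B = (\<Sum>i\<in>B. c i * real_of_int (z i))" for z :: "nat \<Rightarrow> int" and B
  have \<tau>: "\<tau> = 1 \<or> \<tau> = - 1" by (simp add: \<tau>_def)
  have sums: "label_sum z L = \<tau> * X z L" "label_sum z R = - (\<tau> * X z R)"
    "X z L + X z R = X z same + X z diff"
    "\<bar>label_sum z L\<bar> + \<bar>label_sum z R\<bar> = max (\<bar>X z L - X z R\<bar>) (\<bar>X z L + X z R\<bar>)"
    "\<bar>label_sum z (left_child n x f2)\<bar> + \<bar>label_sum z (right_child n x f2)\<bar>
      = max (\<bar>X z L - X z R\<bar>) (\<bar>X z same - X z diff\<bar>)" for z
    unfolding L_def R_def same_def diff_def X_def c_def by (rule misclass_sums[OF \<tau>])+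
  have flip_y: "\<forall>i<n. flip_labels y w i \<in> {1, - 1}" for w
    using y by (intro allI impI flip_labels_range) blast
  have gain_diff: "gain misclass n x z f1 - gain misclass n x z f2
      = (max (\<bar>X z L - X z R\<bar>) (\<bar>X z L + X z R\<bar>) - max (\<bar>X z L - X z R\<bar>) (\<bar>X z same - X z diff\<bar>)) / (2 * n)"
    if "\<forall>i<n. z i \<in> {1, - 1}" for z
    unfolding gain_misclass_eq[OF assms(1) that] sums(4)[symmetric] sums(5)[symmetric]
    by (simp add: L_def R_def diff_divide_distrib add_divide_distrib)
  have margin: "2 * (n * \<rho>) = max (\<bar>X y L - X y R\<bar>) (\<bar>X y L + X y R\<bar>) - max (\<bar>X y L - X y R\<bar>) (\<bar>X y same - X y diff\<bar>)"
    unfolding \<rho>(1) gain_diff[OF y] using assms(1) by simp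
  have X_nonneg: "0 \<le> X y L" using sums(1)[of y] \<tau> by (auto simp: \<tau>_def split: if_splits)
  have "0 < n * \<rho>" using assms(1) \<rho>(2) by simp
  \<comment> \<open>Without noise all four signed sums are at least \<open>n * \<rho>\<close>, the
    margin for \<open>Pr_not_all_four_pos\<close>.\<close>
  note big = max_abs_margin[OF X_nonneg this sums(3) margin]
  define s where "s i = (if i < n then c i * real_of_int (y i) else 1)" for i
  have s_sum: "(\<Sum>i\<in>B. s i) = X y B" "(\<Sum>i\<in>B. s i * sg (w i)) = X (flip_labels y w) B" if "B \<subseteq> {..<n}" for B w
    unfolding X_def using that by (auto intro!: sum.cong simp: s_def real_flip_labels)
  have sub: "L \<subseteq> {..<n}" "R \<subseteq> {..<n}" "same \<subseteq> {..<n}" "diff \<subseteq> {..<n}"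
    by (auto simp: L_def R_def same_def diff_def left_child_def right_child_def)
  have s: "s i = 1 \<or> s i = - 1" if "i \<in> {..<n}" for i
    using y[rule_format, of i] \<tau> that by (auto simp: s_def c_def)
  have "Pr {..<n} (\<lambda>w. \<not> gain misclass n x (flip_labels y w) f2 < gain misclass n x (flip_labels y w) f1)
    \<le> Pr {..<n} (\<lambda>w. \<not> ((0 < (\<Sum>i\<in>L. s i * sg (w i)) \<and> 0 < (\<Sum>i\<in>R. s i * sg (w i)))
      \<and> (0 < (\<Sum>i\<in>same. s i * sg (w i)) \<and> 0 < (\<Sum>i\<in>diff. s i * sg (w i)))))"
  proof (intro Pr_mono finite_lessThan notI)
    fix w :: "nat \<Rightarrow> bool"
    let ?z = "flip_labels y w"
    assume fail: "\<not> gain misclass n x ?z f2 < gain misclass n x ?z f1"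
      and "(0 < (\<Sum>i\<in>L. s i * sg (w i)) \<and> 0 < (\<Sum>i\<in>R. s i * sg (w i)))
      \<and> (0 < (\<Sum>i\<in>same. s i * sg (w i)) \<and> 0 < (\<Sum>i\<in>diff. s i * sg (w i)))"
    then have "0 < X ?z L" "0 < X ?z R" "0 < X ?z same" "0 < X ?z diff"
      using sub by (simp_all add: s_sum)
    then have "0 < max (\<bar>X ?z L - X ?z R\<bar>) (\<bar>X ?z L + X ?z R\<bar>) - max (\<bar>X ?z L - X ?z R\<bar>) (\<bar>X ?z same - X ?z diff\<bar>)"
      using max_abs_less[OF _ _ _ _ sums(3), of ?z] by simp
    then have "0 < gain misclass n x ?z f1 - gain misclass n x ?z f2"
      unfolding gain_diff[OF flip_y[of w]] using assms(1) by (intro divide_pos_pos) auto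
    then show False using fail by simp
  qed
  also have "\<dots> \<le> exp (- (n * \<mu>\<^sup>2 * \<rho>\<^sup>2 / rate))"
    using assms(1,2) \<rho>(2) s sub big by (intro Pr_not_all_four_pos) (auto simp: s_sum)
  finally show ?thesis .
qed

end

text \<open>A flip of rate \<open>\<eta>\<close> is the negation of one of rate
  \<open>1 - \<eta>\<close>. Only coordinates in \<open>A\<close> are negated, since those outside
  have the default value \<open>False\<close> for both rates.\<close>

lemma E_complement:
  assumes "flip_rate \<eta>" "finite A"
  shows "measure_pmf.expectation (flip_rate.flips \<eta> A) f
    = measure_pmf.expectation (flip_rate.flips (1 - \<eta>) A) (\<lambda>w. f (\<lambda>i. if i \<in> A then \<not> w i else w i) :: real)"
proof -
  interpret p: flip_rate \<eta> by fact
  interpret q: flip_rate "1 - \<eta>" by unfold_locales (use p.eta_nonneg p.eta_le_1 in auto)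
  show ?thesis
    using assms(2)
  proof (induction A arbitrary: f rule: finite_induct)
    case empty
    show ?case by (simp add: p.E_empty q.E_empty)
  next
    case (insert a A)
    have upd: "(\<lambda>i. if i \<in> insert a A then \<not> (w(a := b)) i else (w(a := b)) i)
        = (\<lambda>i. if i \<in> A then \<not> w i else w i)(a := \<not> b)" for w :: "'a \<Rightarrow> bool" and b
      using insert(2) by (auto simp: fun_eq_iff)
    show ?case
      unfolding p.E_insert[OF insert(1,2)] q.E_insert[OF insert(1,2)] upd
      by (subst (1 2) insert.IH) simp
  qed
qed

lemma label_sum_uminus:
  "(\<And>i. i \<in> A \<Longrightarrow> z' i = - z i) \<Longrightarrow> label_sum z' A = - label_sum z A"
  unfolding label_sum_def by (simp add: sum_negf)

text \<open>Only absolute values of label sums enter the gain.\<close>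

lemma gain_misclass_uminus:
  assumes "0 < n" "\<forall>i<n. z i \<in> {1, - 1}" "\<And>i. i < n \<Longrightarrow> z' i = - z i"
  shows "gain misclass n x z' f = gain misclass n x z f"
proof -
  have z': "\<forall>i<n. z' i \<in> {1, - 1}" using assms(2,3) by fastforce
  have "label_sum z' B = - label_sum z B" if "B \<subseteq> {..<n}" for B
    using that assms(3) by (intro label_sum_uminus) auto
  then show ?thesis
    unfolding gain_misclass_eq[OF assms(1,2)] gain_misclass_eq[OF assms(1) z'] by (simp add: children)
qed

text \<open>The argument with four sums requires positive \<open>\<mu>\<close>. Above 1/2, negating
  all noisy labels replaces the rate by \<open>1 - \<eta>\<close> and preserves both the gain and
  \<open>\<mu>\<^sup>2\<close>.\<close>

lemma (in flip_rate) misclass_failure: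
  assumes "0 < n" "\<eta> \<noteq> 1 / 2" and y: "\<forall>i<n. y i \<in> {1, - 1}"
    and \<rho>: "\<rho> = gain misclass n x y f1 - gain misclass n x y f2" "0 < \<rho>"
  shows "Pr {..<n} (\<lambda>w. \<not> gain misclass n x (flip_labels y w) f2 < gain misclass n x (flip_labels y w) f1)
    \<le> exp (- (n * \<mu>\<^sup>2 * \<rho>\<^sup>2 / rate))"
proof (cases "\<eta> < 1 / 2")
  case True
  show ?thesis by (rule misclass_failure_less_half[OF assms(1) True y \<rho>])
next
  case False
  interpret q: flip_rate "1 - \<eta>" by unfold_locales (use eta_nonneg eta_le_1 in auto)
  have flip_y: "\<forall>i<n. flip_labels y w i \<in> {1, - 1}" for w
    using y by (intro allI impI flip_labels_range) blast
  have inv: "gain misclass n x (flip_labels y (\<lambda>i. if i \<in> {..<n} then \<not> w i else w i)) f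
      = gain misclass n x (flip_labels y w) f" for w f
    by (rule gain_misclass_uminus[OF assms(1) flip_y[of w]]) (auto simp: flip_labels_def)
  have "Pr {..<n} (\<lambda>w. \<not> gain misclass n x (flip_labels y w) f2 < gain misclass n x (flip_labels y w) f1)
    = q.Pr {..<n} (\<lambda>w. \<not> gain misclass n x (flip_labels y w) f2 < gain misclass n x (flip_labels y w) f1)"
    by (subst E_complement[OF flip_rate_axioms finite_lessThan]) (simp only: inv)
  also have "\<dots> \<le> exp (- (n * (1 - 2 * (1 - \<eta>))\<^sup>2 * \<rho>\<^sup>2 / rate))"
    using False assms(2) by (intro q.misclass_failure_less_half[OF assms(1) _ y \<rho>]) auto
  also have "(1 - 2 * (1 - \<eta>))\<^sup>2 = \<mu>\<^sup>2" by algebra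
  finally show ?thesis .
qed

theorem lemma8:
  "\<exists>K::real. K > 0 \<and>
     (\<forall>C \<in> {gain gini, gain misclass, twoing}.
      \<forall>(n::nat) (d::nat) (x :: nat \<Rightarrow> real list) (y :: nat \<Rightarrow> int)
        (f1 :: real list \<Rightarrow> bool) (f2 :: real list \<Rightarrow> bool) (\<rho>::real) (\<eta>::real) (\<delta>::real).
        (\<forall>i<n. length (x i) = d) \<longrightarrow>
        (\<forall>i<n. y i \<in> {1, -1}) \<longrightarrow>
        \<rho> = C n x y f1 - C n x y f2 \<longrightarrow> \<rho> > 0 \<longrightarrow>
        0 \<le> \<eta> \<longrightarrow> \<eta> \<le> 1 \<longrightarrow> \<eta> \<noteq> 1 / 2 \<longrightarrow>
        0 < \<delta> \<longrightarrow> \<delta> < 1 \<longrightarrow>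
        real n \<ge> K * (1 / (\<rho>\<^sup>2 * (1 - 2 * \<eta>)\<^sup>2) * ln (1 / \<delta>)) \<longrightarrow>
        measure_pmf.prob (noisy_labels n \<eta> y) {y'. C n x y' f1 > C n x y' f2} \<ge> 1 - \<delta>)"
proof (intro exI[of _ rate] conjI rate_pos ballI allI impI)
  fix C :: "nat \<Rightarrow> (nat \<Rightarrow> real list) \<Rightarrow> (nat \<Rightarrow> int) \<Rightarrow> (real list \<Rightarrow> bool) \<Rightarrow> real"
    and n d :: nat and x y f1 f2 and \<rho> \<eta> \<delta> :: real
  assume C: "C \<in> {gain gini, gain misclass, twoing}" and y: "\<forall>i<n. y i \<in> {1, - 1}"
    and \<rho>: "\<rho> = C n x y f1 - C n x y f2" "0 < \<rho>"
    and \<eta>: "0 \<le> \<eta>" "\<eta> \<le> 1" "\<eta> \<noteq> 1 / 2" and \<delta>: "0 < \<delta>"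
    and n: "rate * (1 / (\<rho>\<^sup>2 * (1 - 2 * \<eta>)\<^sup>2) * ln (1 / \<delta>)) \<le> real n"
  interpret flip_rate \<eta> using \<eta> by unfold_locales
  \<comment> \<open>On an empty node all criteria are 0 by the conventions on division, which
    contradicts \<open>0 < \<rho>\<close>.\<close>
  have "0 < n"
  proof (rule ccontr)
    assume "\<not> 0 < n"
    then have "C n x y f = 0" for f
      using C by (auto simp: gain_def twoing_def node_impurity_def pos_frac_def neg_frac_def gini_def
          misclass_def left_frac_def left_child_def right_child_def)
    then show False using \<rho> by simp
  qed
  have "Pr {..<n} (\<lambda>w. \<not> C n x (flip_labels y w) f2 < C n x (flip_labels y w) f1) \<le> exp (- (n * \<mu>\<^sup>2 * \<rho>\<^sup>2 / rate))"
    using C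
  proof (elim insertE emptyE)
    assume C: "C = gain gini"
    show ?thesis
      unfolding C by (rule square_criterion_failure[where k = "1 / 2" and x = x, OF \<open>0 < n\<close> \<eta>(3) y])
        (use \<rho> \<open>0 < n\<close> in \<open>auto simp: C gain_gini_eq\<close>)
  next
    assume C: "C = twoing"
    show ?thesis
      unfolding C by (rule square_criterion_failure[where k = "1 / 4" and x = x, OF \<open>0 < n\<close> \<eta>(3) y])
        (use \<rho> \<open>0 < n\<close> in \<open>auto simp: C twoing_eq\<close>)
  next
    assume C: "C = gain misclass"
    show ?thesis
      unfolding C using \<rho>(1)[unfolded C] \<rho>(2) by (rule misclass_failure[OF \<open>0 < n\<close> \<eta>(3) y])
  qed
  also have "\<dots> \<le> \<delta>"
    using \<rho>(2) \<eta>(3) \<delta> n by (intro exp_rate_le) auto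
  finally show "1 - \<delta> \<le> measure_pmf.prob (noisy_labels n \<eta> y) {y'. C n x y' f2 < C n x y' f1}"
    unfolding prob_noisy_labels Pr_not[OF finite_lessThan] by simp
qed

end
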